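(* Let $\{\mathcal R(t)\}_{t\ge 0}$ be the resolvent family of the Volterra equation $X(t)=\int_0^t a(t-\tau)AX(\tau)\,d\tau+X_0+Z(t)$ and let $Z$ be an $H$-valued Lévy process. Fix $t>0$. For $n\in\mathbb N$ let $0=t_0<t_1<\dots<t_n=t$ be partitions of $[0,t]$ with mesh tending to $0$, choose points $s_i\in[t_{i-1},t_i]$, and put $\mathcal R_n:=\sum_{i=1}^n \mathcal R(s_i)\chi_{[t_{i-1},t_i]}$ (step functions on $[0,t]$). Then the integrals $\int_0^t \mathcal R_n(t-\tau)\,dZ(\tau)$ (defined as the corresponding finite sums of the form $\sum_k \Phi_n^k(Z(r_{k+1})-Z(r_k))$) converge in probability, the limit $$\int_0^t \mathcal R(t-\tau)\,dZ(\tau):=P\text{-}\lim_{n\to\infty}\int_0^t \mathcal R_n(t-\tau)\,dZ(\tau)$$ does not depend on the choice of the approximating sequence, and it is a well-defined $H$-valued random variable with an infinitely divisible distribution.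
   Context: $H$ is a real separable Hilbert space with inner product $\langle\cdot,\cdot\rangle_H$ and norm $|\cdot|_H$; $L(H)$ denotes bounded linear operators on $H$. $A$ is a closed linear operator in $H$ with dense domain $\mathcal D(A)$, and $a\in L^1_{\mathrm{loc}}(\mathbb R_+)$. The equation is assumed well-posed, with resolvent family $\{\mathcal R(t)\}_{t\ge0}\subset L(H)$: $\mathcal R(t)$ is uniformly bounded on compact intervals, strongly continuous in $t$, $\mathcal R(0)=I$, and the resolvent equation $\mathcal R(t)x=x+\int_0^t a(t-\tau)A\mathcal R(\tau)x\,d\tau$ holds for all $x\in\mathcal D(A)$, $t\ge0$. $(\Omega,\mathcal F,(\mathcal F_t),P)$ is a filtered probability space; an $H$-valued Lévy process $Z$ is an $(\mathcal F_t)$-adapted process with independent and stationary (homogeneous) increments, continuous in probability, with càdlàg paths and $Z(0)=0$. For a step function $\Phi=\sum_{k}\Phi^k\chi_{(r_k,r_{k+1}]}$ with $\Phi^k\in L(H)$, $\int\Phi\,dZ:=\sum_k\Phi^k(Z(r_{k+1})-Z(r_k))$. *)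

theory Defs
  imports "HOL-Probability.Probability"
begin

(* H is modelled by a type 'h of class real_inner + complete_space (Hilbert space),
  separability by second_countable_topology.  L(H) is the type 'h \<Rightarrow>\<^sub>L 'h. *)

definition closed_dense_operator :: "('h::real_inner) set \<Rightarrow> ('h \<Rightarrow> 'h) \<Rightarrow> bool" where
  "closed_dense_operator D A \<longleftrightarrow>
     subspace D \<and> closure D = UNIV \<and>
     (\<forall>x\<in>D. \<forall>y\<in>D. A (x + y) = A x + A y) \<and>
     (\<forall>c. \<forall>x\<in>D. A (c *\<^sub>R x) = c *\<^sub>R A x) \<and>
     closed {(x, A x) | x. x \<in> D}"

definition loc_integrable_Rplus :: "(real \<Rightarrow> real) \<Rightarrow> bool" where
  "loc_integrable_Rplus a \<longleftrightarrow> (\<forall>T\<ge>0. set_integrable lborel {0..T} a)"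

definition resolvent_family ::
  "('h::{real_inner,complete_space,second_countable_topology}) set \<Rightarrow> ('h \<Rightarrow> 'h) \<Rightarrow> (real \<Rightarrow> real)
     \<Rightarrow> (real \<Rightarrow> ('h \<Rightarrow>\<^sub>L 'h)) \<Rightarrow> bool" where
  "resolvent_family D A a R \<longleftrightarrow>
     (\<forall>T\<ge>0. \<exists>C. \<forall>t\<in>{0..T}. norm (R t) \<le> C) \<and>
     (\<forall>x. continuous_on {0..} (\<lambda>t. blinfun_apply (R t) x)) \<and>
     R 0 = id_blinfun \<and>
     (\<forall>x\<in>D. \<forall>t\<ge>0. \<forall>\<tau>\<in>{0..t}. blinfun_apply (R \<tau>) x \<in> D) \<and>
     (\<forall>x\<in>D. \<forall>t\<ge>0.
        has_bochner_integral (restrict_space lborel {0..t})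
          (\<lambda>\<tau>. a (t - \<tau>) *\<^sub>R A (blinfun_apply (R \<tau>) x))
          (blinfun_apply (R t) x - x))"

definition is_filtration :: "'a measure \<Rightarrow> (real \<Rightarrow> 'a measure) \<Rightarrow> bool" where
  "is_filtration M F \<longleftrightarrow>
     (\<forall>t. space (F t) = space M \<and> sets (F t) \<subseteq> sets M) \<and>
     (\<forall>s t. s \<le> t \<longrightarrow> sets (F s) \<subseteq> sets (F t))"

definition levy_process ::
  "'a measure \<Rightarrow> (real \<Rightarrow> 'a measure) \<Rightarrow> (real \<Rightarrow> 'a \<Rightarrow> 'h::{real_inner,complete_space,second_countable_topology}) \<Rightarrow> bool" where
  "levy_process M F Z \<longleftrightarrow>
     prob_space M \<and> is_filtration M F \<and>
     (\<forall>t\<ge>0. Z t \<in> borel_measurable (F t)) \<and>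
     (\<forall>(n::nat) (r::nat \<Rightarrow> real). 0 \<le> r 0 \<and> (\<forall>k<n. r k \<le> r (Suc k)) \<longrightarrow>
        prob_space.indep_vars M (\<lambda>_. borel) (\<lambda>k \<omega>. Z (r (Suc k)) \<omega> - Z (r k) \<omega>) {..<n}) \<and>
     (\<forall>s\<ge>0. \<forall>h\<ge>0. distr M borel (\<lambda>\<omega>. Z (s + h) \<omega> - Z s \<omega>) = distr M borel (\<lambda>\<omega>. Z h \<omega> - Z 0 \<omega>)) \<and>
     (\<forall>t\<ge>0. \<forall>e>0. ((\<lambda>s. measure M {\<omega>\<in>space M. e < dist (Z s \<omega>) (Z t \<omega>)}) \<longlongrightarrow> 0)
                        (at t within {0..})) \<and>
     (\<forall>\<omega>\<in>space M. \<forall>t\<ge>0. continuous (at_right t) (\<lambda>s. Z s \<omega>)) \<and>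
     (\<forall>\<omega>\<in>space M. \<forall>t>0. \<exists>l. ((\<lambda>s. Z s \<omega>) \<longlongrightarrow> l) (at_left t)) \<and>
     (\<forall>\<omega>\<in>space M. Z 0 \<omega> = 0)"

(* Integral of the step function Phi = sum_k Phi^k chi_(r_k, r_(k+1)] (k < K) against Z:
  sum_k Phi^k (Z(r_(k+1)) - Z(r_k)). *)
definition step_integral ::
  "(real \<Rightarrow> 'a \<Rightarrow> 'h::real_normed_vector) \<Rightarrow> (nat \<Rightarrow> ('h \<Rightarrow>\<^sub>L 'h)) \<Rightarrow> (nat \<Rightarrow> real) \<Rightarrow> nat \<Rightarrow> 'a \<Rightarrow> 'h" where
  "step_integral Z \<Phi> r K \<omega> = (\<Sum>k<K. blinfun_apply (\<Phi> k) (Z (r (Suc k)) \<omega> - Z (r k) \<omega>))"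

definition is_partition :: "real \<Rightarrow> nat \<Rightarrow> (nat \<Rightarrow> real) \<Rightarrow> bool" where
  "is_partition t N p \<longleftrightarrow> p 0 = 0 \<and> p N = t \<and> (\<forall>i<N. p i < p (Suc i))"

definition mesh :: "nat \<Rightarrow> (nat \<Rightarrow> real) \<Rightarrow> real" where
  "mesh N p = Max ((\<lambda>i. p (Suc i) - p i) ` {..<N})"

definition conv_in_prob :: "'a measure \<Rightarrow> (nat \<Rightarrow> 'a \<Rightarrow> 'b::metric_space) \<Rightarrow> ('a \<Rightarrow> 'b) \<Rightarrow> bool" where
  "conv_in_prob M X Y \<longleftrightarrow>
     (\<forall>e>0. (\<lambda>n. measure M {\<omega>\<in>space M. e < dist (X n \<omega>) (Y \<omega>)}) \<longlonglongrightarrow> 0)"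

definition infinitely_divisible :: "('h::{real_normed_vector,second_countable_topology}) measure \<Rightarrow> bool" where
  "infinitely_divisible \<mu> \<longleftrightarrow>
     prob_space \<mu> \<and> sets \<mu> = sets borel \<and>
     (\<forall>n::nat. n \<ge> 1 \<longrightarrow> (\<exists>\<nu>. prob_space \<nu> \<and> sets \<nu> = sets borel \<and>
        \<mu> = distr (PiM {..<n} (\<lambda>_. \<nu>)) borel (\<lambda>x. \<Sum>i<n. x i)))"

end

theory Submission
  imports Defs
begin

text \<open>
  The key estimate concerns a finite exchangeable family \<open>\<xi>\<close> whose partial sums are all small in
  probability: then \<open>\<Sum> \<Phi>\<^sub>i \<xi>\<^sub>i\<close> is small in probability for all operators \<open>\<Phi>\<^sub>i\<close> of norm at most \<open>K\<close>,
  uniformly in the number of summands and without any moment assumption. Every signed sum \<open>\<Sum> \<plusminus>\<xi>\<^sub>i\<close>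
  is small, so by the Paley--Zygmund inequality over the signs \<open>\<Sum> |\<xi>\<^sub>i|\<^sup>2\<close> is small. With the mean \<open>T\<close>
  of the \<open>\<Phi>\<^sub>i\<close>, the sum \<open>\<Sum> \<Phi>\<^sub>i \<xi>\<^sub>i\<close> is \<open>T (\<Sum> \<xi>\<^sub>i)\<close> plus \<open>\<Sum> (\<Phi>\<^sub>i - T) \<xi>\<^sub>i\<close>, and exchangeability bounds
  the second moment of the latter by the sum of squares.

  A Riemann sum of \<open>G u = R (t - u)\<close> is compared with the sum over a fine equidistant grid, where the
  increments of \<open>Z\<close> are exchangeable. The difference has coefficients \<open>G u - G v\<close> with \<open>u\<close> close to \<open>v\<close>.
  They are uniformly small on a finite-dimensional subspace, and on a suitable complement \<open>Z\<close> itself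
  is uniformly small in probability. Hence the Riemann sums are Cauchy in probability.

  For infinite divisibility, each grid increment is split into \<open>n\<close> parts. This writes the grid sum
  as a sum of \<open>n\<close> independent terms distributed like the grid sum for the process \<open>Z (u / n)\<close>, which
  converges in probability as well; the limit is taken on the \<open>n\<close>-fold product space.
\<close>

section \<open>Convergence in probability\<close>

text \<open>The closed balls of the Ky Fan metric.\<close>

definition close_in_prob ::
  "'a measure \<Rightarrow> real \<Rightarrow> ('a \<Rightarrow> 'b::metric_space) \<Rightarrow> ('a \<Rightarrow> 'b) \<Rightarrow> bool" where
  "close_in_prob M \<epsilon> X Y \<longleftrightarrow> measure M {\<omega>\<in>space M. \<epsilon> < dist (X \<omega>) (Y \<omega>)} \<le> \<epsilon>"

lemma close_in_prob_commute: "close_in_prob M \<epsilon> X Y \<longleftrightarrow> close_in_prob M \<epsilon> Y X"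
  by (simp add: close_in_prob_def dist_commute)

lemma close_in_prob_diff_0_iff:
  fixes X Y :: "'a \<Rightarrow> 'b::real_normed_vector"
  shows "close_in_prob M \<epsilon> (\<lambda>\<omega>. X \<omega> - Y \<omega>) (\<lambda>_. 0) \<longleftrightarrow> close_in_prob M \<epsilon> X Y"
  by (simp add: close_in_prob_def dist_norm)

lemma close_in_prob_0_iff_distr:
  fixes X :: "'a \<Rightarrow> 'b::{real_normed_vector,second_countable_topology}"
  assumes "X \<in> borel_measurable M"
  shows "close_in_prob M \<epsilon> X (\<lambda>_. 0) \<longleftrightarrow> measure (distr M borel X) {x. \<epsilon> < norm x} \<le> \<epsilon>"
proof -
  have "{x :: 'b. \<epsilon> < norm x} \<in> sets borel" by measurable
  then show ?thesis
    using assms by (simp add: close_in_prob_def measure_distr vimage_def Int_def conj_commute)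
qed

context finite_measure
begin

lemma close_in_prob_mono_dist:
  fixes X Y :: "'a \<Rightarrow> 'b::{metric_space,second_countable_topology}"
    and X' Y' :: "'a \<Rightarrow> 'c::metric_space"
  assumes [measurable]: "X \<in> borel_measurable M" "Y \<in> borel_measurable M"
    and "close_in_prob M \<delta> X Y" "\<delta> \<le> \<epsilon>"
    and "\<And>\<omega>. \<omega> \<in> space M \<Longrightarrow> dist (X \<omega>) (Y \<omega>) \<le> \<delta> \<Longrightarrow> dist (X' \<omega>) (Y' \<omega>) \<le> \<epsilon>"
  shows "close_in_prob M \<epsilon> X' Y'"
proof -
  have "measure M {\<omega>\<in>space M. \<epsilon> < dist (X' \<omega>) (Y' \<omega>)} \<le> measure M {\<omega>\<in>space M. \<delta> < dist (X \<omega>) (Y \<omega>)}"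
    using assms(5) by (intro finite_measure_mono) (auto simp: not_less[symmetric])
  then show ?thesis using assms(3,4) unfolding close_in_prob_def by linarith
qed

lemma close_in_prob_lipschitz:
  fixes X Y :: "'a \<Rightarrow> 'b::{metric_space,second_countable_topology}"
    and f :: "'b \<Rightarrow> 'c::metric_space"
  assumes "X \<in> borel_measurable M" "Y \<in> borel_measurable M"
    and "close_in_prob M \<delta> X Y"
    and lipschitz: "\<And>x y. dist (f x) (f y) \<le> K * dist x y" and "0 \<le> K" "\<delta> \<le> \<epsilon>" "K * \<delta> \<le> \<epsilon>"
  shows "close_in_prob M \<epsilon> (\<lambda>\<omega>. f (X \<omega>)) (\<lambda>\<omega>. f (Y \<omega>))"
proof (rule close_in_prob_mono_dist[OF assms(1-3) \<open>\<delta> \<le> \<epsilon>\<close>])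
  fix \<omega> assume "dist (X \<omega>) (Y \<omega>) \<le> \<delta>"
  then have "K * dist (X \<omega>) (Y \<omega>) \<le> K * \<delta>" using \<open>0 \<le> K\<close> by (rule mult_left_mono)
  then show "dist (f (X \<omega>)) (f (Y \<omega>)) \<le> \<epsilon>" using lipschitz \<open>K * \<delta> \<le> \<epsilon>\<close> by (meson order_trans)
qed

lemma measure_add_less_le:
  fixes X Y U :: "'a \<Rightarrow> real"
  assumes [measurable]: "X \<in> borel_measurable M" "Y \<in> borel_measurable M"
    and U_le: "\<And>\<omega>. \<omega> \<in> space M \<Longrightarrow> U \<omega> \<le> X \<omega> + Y \<omega>"
  shows "measure M {\<omega>\<in>space M. a + b < U \<omega>}
    \<le> measure M {\<omega>\<in>space M. a < X \<omega>} + measure M {\<omega>\<in>space M. b < Y \<omega>}"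
proof -
  have "measure M {\<omega>\<in>space M. a + b < U \<omega>} \<le> measure M ({\<omega>\<in>space M. a < X \<omega>} \<union> {\<omega>\<in>space M. b < Y \<omega>})"
  proof (intro finite_measure_mono subsetI)
    fix \<omega> assume "\<omega> \<in> {\<omega>\<in>space M. a + b < U \<omega>}"
    then show "\<omega> \<in> {\<omega>\<in>space M. a < X \<omega>} \<union> {\<omega>\<in>space M. b < Y \<omega>}" using U_le[of \<omega>] by auto
  qed measurable
  also have "\<dots> \<le> measure M {\<omega>\<in>space M. a < X \<omega>} + measure M {\<omega>\<in>space M. b < Y \<omega>}"
    by (intro measure_Un_le) measurable
  finally show ?thesis .
qed

lemma close_in_prob_combine:
  fixes X Y :: "'a \<Rightarrow> 'b::{metric_space,second_countable_topology}"
    and X' Y' :: "'a \<Rightarrow> 'c::{metric_space,second_countable_topology}"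
    and U V :: "'a \<Rightarrow> 'd::metric_space"
  assumes [measurable]: "X \<in> borel_measurable M" "Y \<in> borel_measurable M"
      "X' \<in> borel_measurable M" "Y' \<in> borel_measurable M"
    and close: "close_in_prob M \<delta> X Y" "close_in_prob M \<delta>' X' Y'"
    and dist_le: "\<And>\<omega>. dist (U \<omega>) (V \<omega>) \<le> dist (X \<omega>) (Y \<omega>) + dist (X' \<omega>) (Y' \<omega>)"
  shows "close_in_prob M (\<delta> + \<delta>') U V"
proof -
  have "measure M {\<omega>\<in>space M. \<delta> + \<delta>' < dist (U \<omega>) (V \<omega>)}
      \<le> measure M {\<omega>\<in>space M. \<delta> < dist (X \<omega>) (Y \<omega>)} + measure M {\<omega>\<in>space M. \<delta>' < dist (X' \<omega>) (Y' \<omega>)}"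
    by (intro measure_add_less_le dist_le) measurable
  then show ?thesis using close unfolding close_in_prob_def by linarith
qed

lemma close_in_prob_triangle:
  fixes X Y W :: "'a \<Rightarrow> 'b::{metric_space,second_countable_topology}"
  assumes "X \<in> borel_measurable M" "Y \<in> borel_measurable M" "W \<in> borel_measurable M"
    and "close_in_prob M \<delta> X Y" "close_in_prob M \<delta>' Y W"
  shows "close_in_prob M (\<delta> + \<delta>') X W"
  using close_in_prob_combine[OF assms(1,2,2,3,4,5)] dist_triangle by blast

lemma close_in_prob_half_triangle:
  fixes X Y W :: "'a \<Rightarrow> 'b::{metric_space,second_countable_topology}"
  assumes "X \<in> borel_measurable M" "Y \<in> borel_measurable M" "W \<in> borel_measurable M"
    and "close_in_prob M (\<epsilon> / 2) X Y" "close_in_prob M (\<epsilon> / 2) Y W"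
  shows "close_in_prob M \<epsilon> X W"
  using close_in_prob_triangle[OF assms] by simp

lemma close_in_prob_add:
  fixes X Y X' Y' :: "'a \<Rightarrow> 'b::{real_normed_vector,second_countable_topology}"
  assumes "X \<in> borel_measurable M" "Y \<in> borel_measurable M"
      "X' \<in> borel_measurable M" "Y' \<in> borel_measurable M"
    and "close_in_prob M \<delta> X Y" "close_in_prob M \<delta>' X' Y'"
  shows "close_in_prob M (\<delta> + \<delta>') (\<lambda>\<omega>. X \<omega> + X' \<omega>) (\<lambda>\<omega>. Y \<omega> + Y' \<omega>)"
  by (rule close_in_prob_combine[OF assms]) (rule dist_triangle_add)

lemma conv_in_prob_iff_eventually_close:
  fixes X :: "nat \<Rightarrow> 'a \<Rightarrow> 'b::{metric_space,second_countable_topology}"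
  assumes [measurable]: "\<And>n. X n \<in> borel_measurable M" "Y \<in> borel_measurable M"
  shows "conv_in_prob M X Y \<longleftrightarrow>
    (\<forall>\<epsilon>>0. eventually (\<lambda>n. close_in_prob M \<epsilon> (X n) Y) sequentially)"
proof (intro iffI allI impI)
  fix \<epsilon> :: real assume "conv_in_prob M X Y" "0 < \<epsilon>"
  then have "(\<lambda>n. measure M {\<omega>\<in>space M. \<epsilon> < dist (X n \<omega>) (Y \<omega>)}) \<longlonglongrightarrow> 0"
    by (simp add: conv_in_prob_def)
  then have "eventually (\<lambda>n. measure M {\<omega>\<in>space M. \<epsilon> < dist (X n \<omega>) (Y \<omega>)} < \<epsilon>) sequentially"
    using \<open>0 < \<epsilon>\<close> by (rule order_tendstoD(2))
  then show "eventually (\<lambda>n. close_in_prob M \<epsilon> (X n) Y) sequentially"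
    by eventually_elim (simp add: close_in_prob_def)
next
  assume close: "\<forall>\<epsilon>>0. eventually (\<lambda>n. close_in_prob M \<epsilon> (X n) Y) sequentially"
  show "conv_in_prob M X Y"
    unfolding conv_in_prob_def
  proof (intro allI impI tendstoI)
    fix \<epsilon> \<rho> :: real assume "0 < \<epsilon>" "0 < \<rho>"
    define \<delta> where "\<delta> = min \<epsilon> (\<rho> / 2)"
    have \<delta>: "0 < \<delta>" "\<delta> \<le> \<epsilon>" "\<delta> < \<rho>" using \<open>0 < \<epsilon>\<close> \<open>0 < \<rho>\<close> by (auto simp: \<delta>_def)
    from close \<delta>(1) have "eventually (\<lambda>n. close_in_prob M \<delta> (X n) Y) sequentially" by blast
    then show "eventually (\<lambda>n. dist (measure M {\<omega>\<in>space M. \<epsilon> < dist (X n \<omega>) (Y \<omega>)}) 0 < \<rho>) sequentially"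
    proof eventually_elim
      case (elim n)
      have "measure M {\<omega>\<in>space M. \<epsilon> < dist (X n \<omega>) (Y \<omega>)} \<le> measure M {\<omega>\<in>space M. \<delta> < dist (X n \<omega>) (Y \<omega>)}"
        using \<delta>(2) by (intro finite_measure_mono) auto
      then show ?case using elim \<delta>(3) by (simp add: close_in_prob_def)
    qed
  qed
qed

lemma AE_tendsto_imp_conv_in_prob:
  fixes X :: "nat \<Rightarrow> 'a \<Rightarrow> 'b::{metric_space,second_countable_topology}"
  assumes [measurable]: "\<And>n. X n \<in> borel_measurable M" "Y \<in> borel_measurable M"
    and lim: "AE \<omega> in M. (\<lambda>n. X n \<omega>) \<longlonglongrightarrow> Y \<omega>"
  shows "conv_in_prob M X Y"
  unfolding conv_in_prob_def
proof (intro allI impI)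
  fix \<epsilon> :: real assume "0 < \<epsilon>"
  let ?B = "\<lambda>n. {\<omega>\<in>space M. \<epsilon> < dist (X n \<omega>) (Y \<omega>)}"
  have "(\<lambda>n. integral\<^sup>L M (indicator (?B n) :: 'a \<Rightarrow> real)) \<longlonglongrightarrow> integral\<^sup>L M (\<lambda>_. 0)"
  proof (rule integral_dominated_convergence[where w = "\<lambda>_. 1"])
    show "AE \<omega> in M. (\<lambda>n. indicator (?B n) \<omega> :: real) \<longlonglongrightarrow> 0"
      using lim
    proof eventually_elim
      case (elim \<omega>)
      then have "eventually (\<lambda>n. dist (X n \<omega>) (Y \<omega>) < \<epsilon>) sequentially"
        using \<open>0 < \<epsilon>\<close> by (rule tendstoD)
      then have "eventually (\<lambda>n. (indicator (?B n) \<omega> :: real) = 0) sequentially"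
        by eventually_elim (auto simp: indicator_def)
      then show ?case by (rule tendsto_eventually)
    qed
  qed (auto simp: indicator_def)
  then show "(\<lambda>n. measure M (?B n)) \<longlonglongrightarrow> 0" by simp
qed

lemma conv_in_prob_lipschitz:
  fixes X :: "nat \<Rightarrow> 'a \<Rightarrow> 'b::{metric_space,second_countable_topology}"
    and f :: "'b \<Rightarrow> 'c::{metric_space,second_countable_topology}"
  assumes meas [measurable]: "\<And>n. X n \<in> borel_measurable M" "Y \<in> borel_measurable M"
    and conv: "conv_in_prob M X Y" and lipschitz: "\<And>x y. dist (f x) (f y) \<le> K * dist x y" and "0 \<le> K"
  shows "conv_in_prob M (\<lambda>n \<omega>. f (X n \<omega>)) (\<lambda>\<omega>. f (Y \<omega>))"
proof -
  have "K-lipschitz_on UNIV f" using lipschitz \<open>0 \<le> K\<close> by (intro lipschitz_onI) auto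
  then have [measurable]: "f \<in> borel_measurable borel"
    by (intro borel_measurable_continuous_onI lipschitz_on_continuous_on)
  have "eventually (\<lambda>n. close_in_prob M \<epsilon> (\<lambda>\<omega>. f (X n \<omega>)) (\<lambda>\<omega>. f (Y \<omega>))) sequentially" if "0 < \<epsilon>" for \<epsilon>
  proof -
    have pos: "0 < \<epsilon> / (K + 1)" using that \<open>0 \<le> K\<close> by simp
    have scaled_le: "\<epsilon> / (K + 1) \<le> \<epsilon>" "K * (\<epsilon> / (K + 1)) \<le> \<epsilon>"
      using that \<open>0 \<le> K\<close> by (simp_all add: field_simps)
    from conv pos have "eventually (\<lambda>n. close_in_prob M (\<epsilon> / (K + 1)) (X n) Y) sequentially"
      unfolding conv_in_prob_iff_eventually_close[OF meas] by blast
    then show ?thesis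
      by eventually_elim (rule close_in_prob_lipschitz[OF meas _ lipschitz \<open>0 \<le> K\<close> scaled_le])
  qed
  then show ?thesis by (subst conv_in_prob_iff_eventually_close) auto
qed

lemma conv_in_prob_add:
  fixes X X' :: "nat \<Rightarrow> 'a \<Rightarrow> 'b::{real_normed_vector,second_countable_topology}"
  assumes meas: "\<And>n. X n \<in> borel_measurable M" "Y \<in> borel_measurable M"
      "\<And>n. X' n \<in> borel_measurable M" "Y' \<in> borel_measurable M"
    and conv: "conv_in_prob M X Y" and conv': "conv_in_prob M X' Y'"
  shows "conv_in_prob M (\<lambda>n \<omega>. X n \<omega> + X' n \<omega>) (\<lambda>\<omega>. Y \<omega> + Y' \<omega>)"
proof -
  note [measurable] = meas
  have "eventually (\<lambda>n. close_in_prob M \<epsilon> (\<lambda>\<omega>. X n \<omega> + X' n \<omega>) (\<lambda>\<omega>. Y \<omega> + Y' \<omega>)) sequentially"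
    if "0 < \<epsilon>" for \<epsilon>
  proof -
    have "eventually (\<lambda>n. close_in_prob M (\<epsilon> / 2) (X n) Y) sequentially"
      "eventually (\<lambda>n. close_in_prob M (\<epsilon> / 2) (X' n) Y') sequentially"
      using conv conv' half_gt_zero[OF that] meas by (simp_all add: conv_in_prob_iff_eventually_close)
    then show ?thesis
      by eventually_elim (use close_in_prob_add[OF meas(1,2,3,4)] in force)
  qed
  then show ?thesis by (subst conv_in_prob_iff_eventually_close) auto
qed

lemma conv_in_prob_sum:
  fixes X :: "'i \<Rightarrow> nat \<Rightarrow> 'a \<Rightarrow> 'b::{real_normed_vector,second_countable_topology}"
  assumes "finite I" "\<And>i n. i \<in> I \<Longrightarrow> X i n \<in> borel_measurable M"
    "\<And>i. i \<in> I \<Longrightarrow> Y i \<in> borel_measurable M" "\<And>i. i \<in> I \<Longrightarrow> conv_in_prob M (X i) (Y i)"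
  shows "conv_in_prob M (\<lambda>n \<omega>. \<Sum>i\<in>I. X i n \<omega>) (\<lambda>\<omega>. \<Sum>i\<in>I. Y i \<omega>)"
  using assms
proof (induction I rule: finite_induct)
  case empty
  show ?case by (simp add: conv_in_prob_def)
next
  case (insert i I)
  then have "conv_in_prob M (\<lambda>n \<omega>. X i n \<omega> + (\<Sum>i\<in>I. X i n \<omega>)) (\<lambda>\<omega>. Y i \<omega> + (\<Sum>i\<in>I. Y i \<omega>))"
    by (intro conv_in_prob_add borel_measurable_sum) auto
  then show ?case using insert.hyps by simp
qed

end

subsection \<open>Completeness\<close>

lemma summable_dist_imp_Cauchy:
  fixes x :: "nat \<Rightarrow> 'b::metric_space"
  assumes "summable (\<lambda>j. dist (x j) (x (Suc j)))"
  shows "Cauchy x"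
proof (rule metric_CauchyI)
  fix \<epsilon> :: real assume "0 < \<epsilon>"
  have chain: "dist (x m) (x n) \<le> (\<Sum>j\<in>{m..<n}. dist (x j) (x (Suc j)))" if "m \<le> n" for m n
    using that
  proof (induction n rule: dec_induct)
    case (step n)
    then show ?case using dist_triangle[of "x m" "x (Suc n)" "x n"] by simp
  qed simp
  obtain K where "\<And>m n. m \<ge> K \<Longrightarrow> norm (\<Sum>j\<in>{m..<n}. dist (x j) (x (Suc j))) < \<epsilon>"
    using assms \<open>0 < \<epsilon>\<close> unfolding summable_Cauchy by blast
  then have "dist (x m) (x n) < \<epsilon>" if "K \<le> m" "m \<le> n" for m n
    using chain[OF that(2)] that(1) by (smt (verit) real_norm_def)
  then have "dist (x m) (x n) < \<epsilon>" if "K \<le> m" "K \<le> n" for m n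
    using that by (metis dist_commute nat_le_linear)
  then show "\<exists>K. \<forall>m\<ge>K. \<forall>n\<ge>K. dist (x m) (x n) < \<epsilon>" by blast
qed

lemma borel_measurable_lim_if_Cauchy:
  fixes X :: "nat \<Rightarrow> 'a \<Rightarrow> 'b::{complete_space,second_countable_topology}"
  assumes [measurable]: "\<And>n. X n \<in> borel_measurable M"
  obtains Y where "Y \<in> borel_measurable M"
    "\<And>\<omega>. Cauchy (\<lambda>n. X n \<omega>) \<Longrightarrow> (\<lambda>n. X n \<omega>) \<longlonglongrightarrow> Y \<omega>"
proof
  let ?Y = "\<lambda>\<omega>. if Cauchy (\<lambda>n. X n \<omega>) then lim (\<lambda>n. X n \<omega>) else undefined"
  have "{\<omega>\<in>space M. Cauchy (\<lambda>n. X n \<omega>)} \<in> sets M"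
    by (rule sets_Collect_Cauchy) simp
  then have "(\<lambda>\<omega>. if Cauchy (\<lambda>n. X n \<omega>) then X i \<omega> else undefined) \<in> borel_measurable M" for i
    by (intro measurable_If) auto
  then show "?Y \<in> borel_measurable M"
    by (rule borel_measurable_LIMSEQ_metric)
      (auto simp: Cauchy_convergent_iff convergent_LIMSEQ_iff)
  show "(\<lambda>n. X n \<omega>) \<longlonglongrightarrow> ?Y \<omega>" if "Cauchy (\<lambda>n. X n \<omega>)" for \<omega>
    using that by (simp add: Cauchy_convergent_iff convergent_LIMSEQ_iff)
qed

context finite_measure
begin

lemma AE_Cauchy_if_close_in_prob_geometric:
  fixes X :: "nat \<Rightarrow> 'a \<Rightarrow> 'b::{metric_space,second_countable_topology}"
  assumes [measurable]: "\<And>n. X n \<in> borel_measurable M"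
    and close: "\<And>j. close_in_prob M ((1 / 2) ^ j) (X j) (X (Suc j))"
  shows "AE \<omega> in M. Cauchy (\<lambda>j. X j \<omega>)"
proof -
  let ?A = "\<lambda>j. {\<omega>\<in>space M. (1 / 2) ^ j < dist (X j \<omega>) (X (Suc j) \<omega>)}"
  have "summable (\<lambda>j. measure M (?A j))"
    using close unfolding close_in_prob_def
    by (intro summable_comparison_test[OF _ summable_geometric[of "1 / 2 :: real"]]) auto
  then have "AE \<omega> in M. eventually (\<lambda>j. \<omega> \<in> space M - ?A j) sequentially"
    by (intro borel_cantelli_AE1) (auto simp: less_top[symmetric])
  then show ?thesis
  proof eventually_elim
    case (elim \<omega>)
    then have "eventually (\<lambda>j. norm (dist (X j \<omega>) (X (Suc j) \<omega>)) \<le> (1 / 2) ^ j) sequentially"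
      by eventually_elim auto
    then have "summable (\<lambda>j. dist (X j \<omega>) (X (Suc j) \<omega>))"
      by (rule summable_comparison_test_ev) (rule summable_geometric, simp)
    then show ?case by (rule summable_dist_imp_Cauchy)
  qed
qed

lemma conv_in_prob_if_Cauchy_in_prob:
  fixes X :: "nat \<Rightarrow> 'a \<Rightarrow> 'b::{complete_space,second_countable_topology}"
  assumes meas [measurable]: "\<And>n. X n \<in> borel_measurable M"
    and Cauchy: "\<And>\<epsilon>. 0 < \<epsilon> \<Longrightarrow> \<exists>K. \<forall>m\<ge>K. \<forall>n\<ge>K. close_in_prob M \<epsilon> (X m) (X n)"
  obtains Y where "Y \<in> borel_measurable M" "conv_in_prob M X Y"
proof -
  have "\<forall>j. \<exists>K. \<forall>m\<ge>K. \<forall>n\<ge>K. close_in_prob M ((1 / 2) ^ j) (X m) (X n)"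
    by (intro allI Cauchy) simp
  then obtain K where K_close: "\<And>j m n. m \<ge> K j \<Longrightarrow> n \<ge> K j \<Longrightarrow> close_in_prob M ((1 / 2) ^ j) (X m) (X n)"
    by metis
  define r where "r j = j + (\<Sum>i\<le>j. K i)" for j :: nat
  have r_ge: "K j \<le> r j" "K j \<le> r (Suc j)" "j \<le> r j" for j
    using member_le_sum[of j "{..j}" K] by (auto simp: r_def)
  obtain Y where meas_Y [measurable]: "Y \<in> borel_measurable M"
    and lim: "\<And>\<omega>. Cauchy (\<lambda>j. X (r j) \<omega>) \<Longrightarrow> (\<lambda>j. X (r j) \<omega>) \<longlonglongrightarrow> Y \<omega>"
    using borel_measurable_lim_if_Cauchy[of "\<lambda>j. X (r j)" M] by auto
  have "AE \<omega> in M. Cauchy (\<lambda>j. X (r j) \<omega>)"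
    by (intro AE_Cauchy_if_close_in_prob_geometric K_close r_ge) simp
  then have "AE \<omega> in M. (\<lambda>j. X (r j) \<omega>) \<longlonglongrightarrow> Y \<omega>"
    by eventually_elim (rule lim)
  then have sub: "conv_in_prob M (\<lambda>j. X (r j)) Y"
    by (intro AE_tendsto_imp_conv_in_prob) auto
  have "eventually (\<lambda>n. close_in_prob M \<epsilon> (X n) Y) sequentially" if "0 < \<epsilon>" for \<epsilon>
  proof -
    have "0 < \<epsilon> / 2" using that by simp
    then obtain L where L_close: "\<And>m n. m \<ge> L \<Longrightarrow> n \<ge> L \<Longrightarrow> close_in_prob M (\<epsilon> / 2) (X m) (X n)"
      using Cauchy by blast
    have "eventually (\<lambda>j. close_in_prob M (\<epsilon> / 2) (X (r j)) Y) sequentially"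
      using sub \<open>0 < \<epsilon> / 2\<close> by (simp add: conv_in_prob_iff_eventually_close)
    from eventually_happens'[OF sequentially_bot eventually_conj[OF eventually_ge_at_top[of L] this]]
    obtain j where X_r_j_close: "L \<le> j" "close_in_prob M (\<epsilon> / 2) (X (r j)) Y" by blast
    have "close_in_prob M \<epsilon> (X n) Y" if "L \<le> n" for n
      by (rule close_in_prob_half_triangle[OF meas meas meas_Y L_close[OF that] X_r_j_close(2)])
        (use X_r_j_close(1) r_ge(3)[of j] in simp)
    then show ?thesis unfolding eventually_sequentially by blast
  qed
  then have "conv_in_prob M X Y" by (simp add: conv_in_prob_iff_eventually_close)
  then show thesis using that meas_Y by blast
qed

end

subsection \<open>Limits in probability and distributions\<close>

lemma (in prob_space) conv_in_prob_imp_expectation_tendsto: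
  fixes X :: "nat \<Rightarrow> 'a \<Rightarrow> real"
  assumes [measurable]: "\<And>n. X n \<in> borel_measurable M" "Y \<in> borel_measurable M"
    and conv: "conv_in_prob M X Y" and bound: "\<And>n \<omega>. \<bar>X n \<omega>\<bar> \<le> B" "\<And>\<omega>. \<bar>Y \<omega>\<bar> \<le> B"
  shows "(\<lambda>n. expectation (X n)) \<longlonglongrightarrow> expectation Y"
proof (rule metric_LIMSEQ_I)
  fix \<rho> :: real assume "0 < \<rho>"
  have int: "integrable M (X n)" "integrable M Y" for n
    using bound by (auto intro!: integrable_const_bound[of _ B])
  have B_nonneg: "0 \<le> B" using bound(2)[of undefined] by linarith
  define \<delta> where "\<delta> = \<rho> / 2 / (1 + 2 * B)"
  have "(1 + 2 * B) * \<delta> = \<rho> / 2"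
    using B_nonneg unfolding \<delta>_def
    by (subst times_divide_eq_right, intro nonzero_mult_div_cancel_left) simp
  then have \<delta>: "\<delta> + 2 * B * \<delta> < \<rho>" "0 < \<delta>"
    using \<open>0 < \<rho>\<close> B_nonneg by (simp_all add: distrib_right) (simp add: \<delta>_def)
  have "dist (expectation (X n)) (expectation Y) < \<rho>" if close: "close_in_prob M \<delta> (X n) Y" for n
  proof -
    let ?A = "{\<omega>\<in>space M. \<delta> < dist (X n \<omega>) (Y \<omega>)}"
    have "dist (expectation (X n)) (expectation Y) = \<bar>expectation (\<lambda>\<omega>. X n \<omega> - Y \<omega>)\<bar>"
      by (simp add: dist_real_def int)
    also have "\<dots> \<le> expectation (\<lambda>\<omega>. \<bar>X n \<omega> - Y \<omega>\<bar>)"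
      by (rule integral_abs_bound)
    also have "\<dots> \<le> expectation (\<lambda>\<omega>. \<delta> + 2 * B * indicator ?A \<omega>)"
    proof (rule integral_mono)
      show "\<bar>X n \<omega> - Y \<omega>\<bar> \<le> \<delta> + 2 * B * indicator ?A \<omega>" if "\<omega> \<in> space M" for \<omega>
        using that bound(1)[of n \<omega>] bound(2)[of \<omega>] \<delta>(2)
        by (auto simp: dist_real_def indicator_def)
    qed (auto simp: int less_top[symmetric])
    also have "\<dots> = \<delta> + 2 * B * prob ?A"
      by (subst Bochner_Integration.integral_add) (auto simp: prob_space less_top[symmetric])
    also have "\<dots> \<le> \<delta> + 2 * B * \<delta>"
      using close B_nonneg by (intro add_left_mono mult_left_mono) (auto simp: close_in_prob_def)
    finally show ?thesis using \<delta>(1) by simp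
  qed
  moreover have "eventually (\<lambda>n. close_in_prob M \<delta> (X n) Y) sequentially"
    using conv \<delta>(2) by (simp add: conv_in_prob_iff_eventually_close)
  ultimately show "\<exists>K. \<forall>n\<ge>K. dist (expectation (X n)) (expectation Y) < \<rho>"
    unfolding eventually_sequentially by blast
qed

text \<open>Lipschitz approximations of the indicator function of a closed set.\<close>

definition closed_cutoff :: "'b::metric_space set \<Rightarrow> nat \<Rightarrow> 'b \<Rightarrow> real" where
  "closed_cutoff C k x = max 0 (1 - real k * infdist x C)"

lemma closed_cutoff_bounds: "0 \<le> closed_cutoff C k x" "closed_cutoff C k x \<le> 1"
  by (simp_all add: closed_cutoff_def infdist_nonneg)

lemma closed_cutoff_lipschitz: "dist (closed_cutoff C k x) (closed_cutoff C k y) \<le> real k * dist x y"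
proof -
  have "\<bar>real k * infdist x C - real k * infdist y C\<bar> = real k * \<bar>infdist x C - infdist y C\<bar>"
    by (simp add: abs_mult flip: right_diff_distrib)
  also have "\<dots> \<le> real k * dist x y"
    by (intro mult_left_mono infdist_triangle_abs) simp
  finally show ?thesis by (auto simp: closed_cutoff_def dist_real_def)
qed

lemma closed_cutoff_tendsto_indicator:
  assumes "closed C" "C \<noteq> {}"
  shows "(\<lambda>k. closed_cutoff C k x) \<longlonglongrightarrow> indicator C x"
proof (cases "x \<in> C")
  case True
  then show ?thesis by (simp add: closed_cutoff_def)
next
  case False
  then have pos: "0 < infdist x C"
    using assms infdist_nonneg[of x C] in_closed_iff_infdist_zero[of C x] by force
  obtain K where "1 / infdist x C < real K" using reals_Archimedean2 by blast
  then have "1 \<le> real K * infdist x C" using pos by (simp add: field_simps)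
  then have "1 \<le> real k * infdist x C" if "K \<le> k" for k
    using mult_right_mono[of "real K" "real k" "infdist x C"] that pos by linarith
  then have "closed_cutoff C k x = 0" if "K \<le> k" for k
    using that by (simp add: closed_cutoff_def)
  then have "eventually (\<lambda>k. closed_cutoff C k x = 0) sequentially"
    unfolding eventually_sequentially by blast
  then show ?thesis using False by (simp add: tendsto_eventually)
qed

lemma borel_measurable_closed_cutoff [measurable]: "closed_cutoff C k \<in> borel_measurable borel"
  unfolding closed_cutoff_def[abs_def]
  by (intro borel_measurable_continuous_onI continuous_intros)

lemma prob_space_eqI_bounded_lipschitz:
  fixes \<mu> \<nu> :: "'b::metric_space measure"
  assumes \<mu>: "prob_space \<mu>" "sets \<mu> = sets borel" and \<nu>: "prob_space \<nu>" "sets \<nu> = sets borel"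
    and eq: "\<And>(f :: 'b \<Rightarrow> real) K. (\<And>x. 0 \<le> f x) \<Longrightarrow> (\<And>x. f x \<le> 1) \<Longrightarrow>
      (\<And>x y. dist (f x) (f y) \<le> real K * dist x y) \<Longrightarrow> integral\<^sup>L \<mu> f = integral\<^sup>L \<nu> f"
  shows "\<mu> = \<nu>"
proof (rule measure_eqI_generator_eq[where E = "Collect closed" and A = "\<lambda>_. UNIV" and \<Omega> = UNIV])
  interpret \<mu>: prob_space \<mu> by fact
  interpret \<nu>: prob_space \<nu> by fact
  have lim: "(\<lambda>k. integral\<^sup>L \<kappa> (closed_cutoff C k)) \<longlonglongrightarrow> measure \<kappa> C"
    if "prob_space \<kappa>" "sets \<kappa> = sets borel" "closed C" "C \<noteq> {}" for \<kappa> :: "'b measure" and C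
  proof -
    interpret prob_space \<kappa> by fact
    have [measurable_cong]: "sets \<kappa> = sets borel" by fact
    have "C \<in> sets \<kappa>" using that(2,3) by simp
    moreover from this have "(\<lambda>k. integral\<^sup>L \<kappa> (closed_cutoff C k)) \<longlonglongrightarrow> integral\<^sup>L \<kappa> (indicator C)"
      using closed_cutoff_bounds[of C] closed_cutoff_tendsto_indicator[OF that(3,4)]
      by (intro integral_dominated_convergence[where w = "\<lambda>_. 1"]) auto
    ultimately show ?thesis by simp
  qed
  show "emeasure \<mu> C = emeasure \<nu> C" if "C \<in> Collect closed" for C
  proof (cases "C = {}")
    case False
    have "integral\<^sup>L \<mu> (closed_cutoff C k) = integral\<^sup>L \<nu> (closed_cutoff C k)" for k
      by (rule eq[OF closed_cutoff_bounds closed_cutoff_lipschitz])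
    then have "(\<lambda>k. integral\<^sup>L \<mu> (closed_cutoff C k)) \<longlonglongrightarrow> measure \<nu> C"
      using lim[OF \<nu> _ False] that by simp
    then have "measure \<mu> C = measure \<nu> C"
      using LIMSEQ_unique lim[OF \<mu> _ False] that by blast
    then show ?thesis by (simp add: \<mu>.emeasure_eq_measure \<nu>.emeasure_eq_measure)
  qed simp
  show "Int_stable (Collect closed)" by (auto simp: Int_stable_def)
  show "sets \<mu> = sigma_sets UNIV (Collect closed)" "sets \<nu> = sigma_sets UNIV (Collect closed)"
    by (simp_all add: \<mu>(2) \<nu>(2) borel_eq_closed)
qed (auto simp: finite_measure.emeasure_finite[OF prob_space.finite_measure[OF \<mu>(1)]])

lemma distr_eq_if_conv_in_prob:
  fixes X :: "nat \<Rightarrow> 'a \<Rightarrow> 'b::{metric_space,second_countable_topology}" and X' :: "nat \<Rightarrow> 'c \<Rightarrow> 'b"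
  assumes "prob_space M" and meas [measurable]: "\<And>n. X n \<in> borel_measurable M" "Y \<in> borel_measurable M"
    and "prob_space M'" and meas' [measurable]: "\<And>n. X' n \<in> borel_measurable M'" "Y' \<in> borel_measurable M'"
    and conv: "conv_in_prob M X Y" "conv_in_prob M' X' Y'"
    and eq: "\<And>n. distr M borel (X n) = distr M' borel (X' n)"
  shows "distr M borel Y = distr M' borel Y'"
proof (rule prob_space_eqI_bounded_lipschitz)
  interpret M: prob_space M by fact
  interpret M': prob_space M' by fact
  show "prob_space (distr M borel Y)" "prob_space (distr M' borel Y')"
    by (auto intro: M.prob_space_distr M'.prob_space_distr)
  fix f :: "'b \<Rightarrow> real" and K
  assume nonneg: "\<And>x. 0 \<le> f x" and le1: "\<And>x. f x \<le> 1" and lip: "\<And>x y. dist (f x) (f y) \<le> real K * dist x y"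
  have "(real K)-lipschitz_on UNIV f" using lip by (intro lipschitz_onI) auto
  then have [measurable]: "f \<in> borel_measurable borel"
    by (intro borel_measurable_continuous_onI lipschitz_on_continuous_on)
  have "(\<lambda>n. M.expectation (\<lambda>\<omega>. f (X n \<omega>))) \<longlonglongrightarrow> M.expectation (\<lambda>\<omega>. f (Y \<omega>))"
    using nonneg le1 M.conv_in_prob_lipschitz[OF meas conv(1) lip]
    by (intro M.conv_in_prob_imp_expectation_tendsto[where B = 1]) auto
  moreover have "(\<lambda>n. M'.expectation (\<lambda>\<omega>. f (X' n \<omega>))) \<longlonglongrightarrow> M'.expectation (\<lambda>\<omega>. f (Y' \<omega>))"
    using nonneg le1 M'.conv_in_prob_lipschitz[OF meas' conv(2) lip]
    by (intro M'.conv_in_prob_imp_expectation_tendsto[where B = 1]) auto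
  moreover have "M.expectation (\<lambda>\<omega>. f (X n \<omega>)) = M'.expectation (\<lambda>\<omega>. f (X' n \<omega>))" for n
    using arg_cong[OF eq[of n], of "\<lambda>\<mu>. integral\<^sup>L \<mu> f"] by (simp add: integral_distr)
  ultimately show "integral\<^sup>L (distr M borel Y) f = integral\<^sup>L (distr M' borel Y') f"
    by (simp add: integral_distr LIMSEQ_unique)
qed simp_all

section \<open>Random signs\<close>

definition signed_sum :: "'i set \<Rightarrow> 'i set \<Rightarrow> ('i \<Rightarrow> 'h::real_normed_vector) \<Rightarrow> 'h" where
  "signed_sum I A x = sum x A - sum x (I - A)"

lemma signed_sum_insert:
  assumes "finite I" "a \<notin> I" "A \<subseteq> I"
  shows "signed_sum (insert a I) A x = signed_sum I A x - x a"
    and "signed_sum (insert a I) (insert a A) x = signed_sum I A x + x a"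
proof -
  have "insert a I - A = insert a (I - A)" "insert a I - insert a A = I - A" "finite A" "a \<notin> A"
    using assms by (auto intro: finite_subset)
  then show "signed_sum (insert a I) A x = signed_sum I A x - x a"
    and "signed_sum (insert a I) (insert a A) x = signed_sum I A x + x a"
    using assms by (simp_all add: signed_sum_def)
qed

lemma sum_Pow_insert:
  assumes "finite I" "a \<notin> I"
  shows "(\<Sum>A\<in>Pow (insert a I). f A) = (\<Sum>A\<in>Pow I. f A + f (insert a A))"
proof -
  have "inj_on (insert a) (Pow I)" using assms by (auto simp: inj_on_def)
  moreover have "Pow I \<inter> insert a ` Pow I = {}" using assms by auto
  ultimately show ?thesis
    using assms by (simp add: Pow_insert sum.union_disjoint sum.reindex sum.distrib)
qed

lemma sum_signed_sum_power2:
  fixes x :: "'i \<Rightarrow> 'h::real_inner"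
  assumes "finite I"
  shows "(\<Sum>A\<in>Pow I. (norm (signed_sum I A x))\<^sup>2) = 2 ^ card I * (\<Sum>i\<in>I. (norm (x i))\<^sup>2)"
  using assms
proof (induction I rule: finite_induct)
  case (insert a I)
  have "(\<Sum>A\<in>Pow (insert a I). (norm (signed_sum (insert a I) A x))\<^sup>2)
      = (\<Sum>A\<in>Pow I. 2 * (norm (signed_sum I A x))\<^sup>2 + 2 * (norm (x a))\<^sup>2)"
    unfolding sum_Pow_insert[OF insert.hyps]
    by (intro sum.cong refl)
      (auto simp: signed_sum_insert insert.hyps power2_norm_eq_inner inner_commute algebra_simps)
  also have "\<dots> = 2 ^ card (insert a I) * (\<Sum>i\<in>insert a I. (norm (x i))\<^sup>2)"
    using insert by (simp add: sum.distrib sum_distrib_left[symmetric] card_Pow algebra_simps)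
  finally show ?case .
qed (simp add: signed_sum_def)

lemma norm_power4_diff_add_le:
  fixes a b :: "'h::real_inner"
  shows "norm (a - b) ^ 4 + norm (a + b) ^ 4
    \<le> 2 * norm a ^ 4 + 12 * ((norm a)\<^sup>2 * (norm b)\<^sup>2) + 2 * norm b ^ 4"
proof -
  have power4: "norm z ^ 4 = (z \<bullet> z)\<^sup>2" for z :: 'h
    by (simp add: power2_norm_eq_inner[symmetric] flip: power_mult)
  have "(a \<bullet> b)\<^sup>2 \<le> (a \<bullet> a) * (b \<bullet> b)" by (rule Cauchy_Schwarz_ineq)
  then show ?thesis
    unfolding power4 power2_norm_eq_inner
    by (simp add: inner_commute power2_eq_square algebra_simps)
qed

lemma sum_signed_sum_power4_le:
  fixes x :: "'i \<Rightarrow> 'h::real_inner"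
  assumes "finite I"
  shows "(\<Sum>A\<in>Pow I. norm (signed_sum I A x) ^ 4) \<le> 2 ^ card I * (3 * (\<Sum>i\<in>I. (norm (x i))\<^sup>2)\<^sup>2)"
  using assms
proof (induction I rule: finite_induct)
  case (insert a I)
  let ?Q = "\<Sum>i\<in>I. (norm (x i))\<^sup>2" and ?q = "(norm (x a))\<^sup>2"
  have "(\<Sum>A\<in>Pow (insert a I). norm (signed_sum (insert a I) A x) ^ 4)
      \<le> (\<Sum>A\<in>Pow I. 2 * norm (signed_sum I A x) ^ 4
            + 12 * ((norm (signed_sum I A x))\<^sup>2 * ?q) + 2 * norm (x a) ^ 4)"
    unfolding sum_Pow_insert[OF insert.hyps]
    by (intro sum_mono) (auto simp: signed_sum_insert insert.hyps intro: norm_power4_diff_add_le)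
  also have "\<dots> = 2 * (\<Sum>A\<in>Pow I. norm (signed_sum I A x) ^ 4)
      + 12 * (2 ^ card I * ?Q * ?q) + 2 ^ card I * (2 * norm (x a) ^ 4)"
    by (simp add: sum.distrib sum_distrib_left[symmetric] sum_distrib_right[symmetric]
        sum_signed_sum_power2 card_Pow insert.hyps)
  also have "\<dots> \<le> 2 * (2 ^ card I * (3 * ?Q\<^sup>2)) + 12 * (2 ^ card I * ?Q * ?q) + 2 ^ card I * (2 * ?q\<^sup>2)"
    using insert.IH by (simp flip: power_mult)
  also have "\<dots> = 2 ^ card (insert a I) * (3 * ?Q\<^sup>2 + 6 * (?Q * ?q) + ?q\<^sup>2)"
    using insert.hyps by (simp add: algebra_simps)
  also have "\<dots> \<le> 2 ^ card (insert a I) * (3 * (?Q + ?q)\<^sup>2)"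
    by (intro mult_left_mono) (auto simp: power2_sum algebra_simps)
  finally show ?case using insert.hyps by (simp add: add.commute)
qed (simp add: signed_sum_def)

lemma (in prob_space) Paley_Zygmund:
  assumes [measurable]: "X \<in> borel_measurable M" and int_power2: "integrable M (\<lambda>\<omega>. (X \<omega>)\<^sup>2)"
    and "0 \<le> expectation X" "0 \<le> \<theta>" "\<theta> \<le> 1"
  shows "((1 - \<theta>) * expectation X)\<^sup>2 / expectation (\<lambda>\<omega>. (X \<omega>)\<^sup>2)
    \<le> prob {\<omega>\<in>space M. \<theta> * expectation X < X \<omega>}"
proof -
  define A where "A = {\<omega>\<in>space M. \<theta> * expectation X < X \<omega>}"
  define m where "m = (1 - \<theta>) * expectation X"
  define c where "c = m / expectation (\<lambda>\<omega>. (X \<omega>)\<^sup>2)"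
  have A_event [measurable]: "A \<in> sets M" unfolding A_def by measurable
  have int: "integrable M X" by (rule square_integrable_imp_integrable[OF _ int_power2]) simp
  have int_X_A: "integrable M (\<lambda>\<omega>. X \<omega> * indicator A \<omega>)"
    using int by (intro integrable_real_mult_indicator A_event)
  have int_A: "integrable M (indicator A :: 'a \<Rightarrow> real)"
    by (simp add: less_top[symmetric])
  have "0 \<le> \<theta> * expectation X" using assms by simp
  then have "expectation X \<le> expectation (\<lambda>\<omega>. \<theta> * expectation X + X \<omega> * indicator A \<omega>)"
    using int int_X_A by (intro integral_mono) (auto simp: A_def indicator_def)
  also have "\<dots> = \<theta> * expectation X + expectation (\<lambda>\<omega>. X \<omega> * indicator A \<omega>)"
    using int_X_A by (simp add: prob_space)
  finally have m_le: "m \<le> expectation (\<lambda>\<omega>. X \<omega> * indicator A \<omega>)"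
    by (simp add: m_def algebra_simps)
  have c_nonneg: "0 \<le> c" using assms by (simp add: c_def m_def)
  have "0 \<le> expectation (\<lambda>\<omega>. (c * X \<omega> - indicator A \<omega>)\<^sup>2)" by simp
  also have "(\<lambda>\<omega>. (c * X \<omega> - indicator A \<omega>)\<^sup>2)
      = (\<lambda>\<omega>. c\<^sup>2 * (X \<omega>)\<^sup>2 - 2 * c * (X \<omega> * indicator A \<omega>) + indicator A \<omega>)"
    by (auto simp: fun_eq_iff power2_eq_square indicator_def algebra_simps)
  also have "expectation \<dots>
      = c\<^sup>2 * expectation (\<lambda>\<omega>. (X \<omega>)\<^sup>2) - 2 * c * expectation (\<lambda>\<omega>. X \<omega> * indicator A \<omega>) + prob A"
    using int_power2 int_X_A int_A by simp
  also have "\<dots> \<le> c\<^sup>2 * expectation (\<lambda>\<omega>. (X \<omega>)\<^sup>2) - 2 * c * m + prob A"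
    using m_le c_nonneg by (simp add: mult_left_mono)
  also have "\<dots> = prob A - m\<^sup>2 / expectation (\<lambda>\<omega>. (X \<omega>)\<^sup>2)"
    by (simp add: c_def power2_eq_square)
  finally show ?thesis unfolding A_def m_def by simp
qed

lemma card_signed_sum_gt:
  fixes x :: "'i \<Rightarrow> 'h::real_inner"
  assumes finite_I: "finite I" and Q: "Q = (\<Sum>i\<in>I. (norm (x i))\<^sup>2)" "0 < Q"
  shows "2 ^ card I \<le> 12 * real (card {A \<in> Pow I. Q / 2 < (norm (signed_sum I A x))\<^sup>2})"
proof -
  define p where "p = pmf_of_set (Pow I)"
  define X where "X A = (norm (signed_sum I A x))\<^sup>2" for A
  have Pow_I: "Pow I \<noteq> {}" "finite (Pow I)" using finite_I by auto
  then have fin: "finite (set_pmf p)" by (simp add: p_def)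
  have EX: "measure_pmf.expectation p X = Q"
    using finite_I by (simp add: p_def X_def Q integral_pmf_of_set[OF Pow_I] sum_signed_sum_power2 card_Pow)
  have EX2: "measure_pmf.expectation p (\<lambda>A. (X A)\<^sup>2) \<le> 3 * Q\<^sup>2"
    using sum_signed_sum_power4_le[OF finite_I, of x]
    by (simp add: p_def X_def Q integral_pmf_of_set[OF Pow_I] card_Pow finite_I field_simps flip: power_mult)
  have EX2_pos: "0 < measure_pmf.expectation p (\<lambda>A. (X A)\<^sup>2)"
  proof -
    have "Q\<^sup>2 \<le> measure_pmf.expectation p (\<lambda>A. (X A)\<^sup>2)"
      using measure_pmf.variance_positive[of p X]
      by (subst (asm) measure_pmf.variance_eq) (auto simp: EX integrable_measure_pmf_finite fin)
    then show ?thesis using Q(2) by (smt (verit) zero_less_power)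
  qed
  have "1 / 12 = (Q / 2)\<^sup>2 / (3 * Q\<^sup>2)" using Q(2) by (simp add: power2_eq_square)
  also have "\<dots> \<le> (Q / 2)\<^sup>2 / measure_pmf.expectation p (\<lambda>A. (X A)\<^sup>2)"
    using EX2 EX2_pos Q(2) by (intro divide_left_mono mult_pos_pos) auto
  also have "\<dots> \<le> measure_pmf.prob p {A. Q / 2 < X A}"
    using measure_pmf.Paley_Zygmund[of X p "1 / 2"] Q(2)
    by (simp add: EX integrable_measure_pmf_finite fin)
  also have "\<dots> = real (card {A \<in> Pow I. Q / 2 < X A}) / 2 ^ card I"
    by (simp add: p_def measure_pmf_of_set[OF Pow_I] card_Pow finite_I Int_def)
  finally show ?thesis by (simp add: X_def field_simps)
qed

lemma (in finite_measure) mult_measure_le_sum_measure: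
  assumes "finite J" and [measurable]: "E \<in> sets M" "\<And>a. a \<in> J \<Longrightarrow> B a \<in> sets M"
    and card_ge: "\<And>\<omega>. \<omega> \<in> E \<Longrightarrow> c \<le> real (card {a \<in> J. \<omega> \<in> B a})"
  shows "c * measure M E \<le> (\<Sum>a\<in>J. measure M (B a))"
proof -
  have count: "(\<Sum>a\<in>J. indicator (B a) \<omega>) = real (card {a \<in> J. \<omega> \<in> B a})" for \<omega>
    using \<open>finite J\<close> by (simp add: indicator_def sum.If_cases Int_def)
  have int: "integrable M (indicator S :: 'a \<Rightarrow> real)" if "S \<in> sets M" for S
    using that by (simp add: less_top[symmetric])
  have "c * measure M E = (\<integral>\<omega>. c * indicator E \<omega> \<partial>M)" by simp
  also have "\<dots> \<le> (\<integral>\<omega>. (\<Sum>a\<in>J. indicator (B a) \<omega>) \<partial>M)"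
  proof (rule integral_mono)
    show "c * indicator E \<omega> \<le> (\<Sum>a\<in>J. indicator (B a) \<omega>)" for \<omega>
      unfolding count using card_ge[of \<omega>] by (cases "\<omega> \<in> E") auto
  qed (auto intro!: integrable_sum int)
  also have "\<dots> = (\<Sum>a\<in>J. measure M (B a))"
    by (subst Bochner_Integration.integral_sum) (auto intro!: int sum.cong)
  finally show ?thesis .
qed

lemma borel_measurable_signed_sum:
  fixes \<xi> :: "'i \<Rightarrow> 'a \<Rightarrow> 'h::{real_normed_vector,second_countable_topology}"
  assumes "A \<subseteq> I" "\<And>i. i \<in> I \<Longrightarrow> \<xi> i \<in> borel_measurable M"
  shows "(\<lambda>\<omega>. signed_sum I A (\<lambda>i. \<xi> i \<omega>)) \<in> borel_measurable M"
  unfolding signed_sum_def using assms by (intro borel_measurable_diff borel_measurable_sum) auto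

lemma (in finite_measure) close_in_prob_signed_sum:
  fixes \<xi> :: "'i \<Rightarrow> 'a \<Rightarrow> 'h::{real_normed_vector,second_countable_topology}"
  assumes A_subset: "A \<subseteq> I" and meas: "\<And>i. i \<in> I \<Longrightarrow> \<xi> i \<in> borel_measurable M"
    and small: "\<And>A. A \<subseteq> I \<Longrightarrow> close_in_prob M \<eta> (\<lambda>\<omega>. \<Sum>i\<in>A. \<xi> i \<omega>) (\<lambda>_. 0)"
  shows "close_in_prob M (2 * \<eta>) (\<lambda>\<omega>. signed_sum I A (\<lambda>i. \<xi> i \<omega>)) (\<lambda>_. 0)"
proof -
  have "(\<lambda>\<omega>. \<Sum>i\<in>A. \<xi> i \<omega>) \<in> borel_measurable M" if "A \<subseteq> I" for A
    using that by (intro borel_measurable_sum meas) auto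
  then have "close_in_prob M (\<eta> + \<eta>) (\<lambda>\<omega>. signed_sum I A (\<lambda>i. \<xi> i \<omega>)) (\<lambda>_. 0)"
    using A_subset by (intro close_in_prob_combine[OF _ _ _ _ small[OF A_subset] small[of "I - A"]])
      (auto simp: signed_sum_def norm_triangle_ineq4)
  then show ?thesis by simp
qed

lemma (in prob_space) prob_sum_power2_norm_le:
  fixes \<xi> :: "'i \<Rightarrow> 'a \<Rightarrow> 'h::{real_inner,second_countable_topology}"
  assumes finite_I: "finite I" and meas: "\<And>i. i \<in> I \<Longrightarrow> \<xi> i \<in> borel_measurable M" and "0 < \<eta>"
    and small: "\<And>A. A \<subseteq> I \<Longrightarrow> close_in_prob M \<eta> (\<lambda>\<omega>. \<Sum>i\<in>A. \<xi> i \<omega>) (\<lambda>_. 0)"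
  shows "prob {\<omega>\<in>space M. 8 * \<eta>\<^sup>2 < (\<Sum>i\<in>I. (norm (\<xi> i \<omega>))\<^sup>2)} \<le> 24 * \<eta>"
proof -
  note [measurable] = meas borel_measurable_signed_sum[OF _ meas]
  define E where "E = {\<omega>\<in>space M. 8 * \<eta>\<^sup>2 < (\<Sum>i\<in>I. (norm (\<xi> i \<omega>))\<^sup>2)}"
  define B where "B A = {\<omega>\<in>space M. 2 * \<eta> < norm (signed_sum I A (\<lambda>i. \<xi> i \<omega>))}" for A
  have E_event: "E \<in> sets M" unfolding E_def by measurable
  have B_event: "B A \<in> sets M" if "A \<subseteq> I" for A unfolding B_def using that by measurable
  have prob_B: "prob (B A) \<le> 2 * \<eta>" if "A \<subseteq> I" for A
    using close_in_prob_signed_sum[OF that meas small] by (simp add: close_in_prob_def B_def)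
  have "2 ^ card I / 12 \<le> real (card {A \<in> Pow I. \<omega> \<in> B A})" if \<omega>: "\<omega> \<in> E" for \<omega>
  proof -
    define Q where "Q = (\<Sum>i\<in>I. (norm (\<xi> i \<omega>))\<^sup>2)"
    have Q: "8 * \<eta>\<^sup>2 < Q" "\<omega> \<in> space M" using \<omega> by (auto simp: E_def Q_def)
    have "\<omega> \<in> B A" if "Q / 2 < (norm (signed_sum I A (\<lambda>i. \<xi> i \<omega>)))\<^sup>2" for A
    proof -
      have "(2 * \<eta>)\<^sup>2 < (norm (signed_sum I A (\<lambda>i. \<xi> i \<omega>)))\<^sup>2"
        using that Q by (simp add: power_mult_distrib)
      then show ?thesis using Q(2) by (auto simp: B_def intro: power2_less_imp_less)
    qed
    then have "card {A \<in> Pow I. Q / 2 < (norm (signed_sum I A (\<lambda>i. \<xi> i \<omega>)))\<^sup>2} \<le> card {A \<in> Pow I. \<omega> \<in> B A}"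
      using finite_I by (intro card_mono) auto
    moreover have "0 < Q" using Q(1) zero_le_power2[of \<eta>] by linarith
    ultimately show ?thesis using card_signed_sum_gt[OF finite_I Q_def] by simp
  qed
  then have "2 ^ card I / 12 * prob E \<le> (\<Sum>A\<in>Pow I. prob (B A))"
    using finite_I E_event B_event by (intro mult_measure_le_sum_measure) auto
  also have "\<dots> \<le> (\<Sum>A\<in>Pow I. 2 * \<eta>)" using prob_B by (intro sum_mono) auto
  also have "\<dots> = 2 ^ card I / 12 * (24 * \<eta>)" using finite_I by (simp add: card_Pow)
  finally show ?thesis unfolding E_def by simp
qed

section \<open>Exchangeable families\<close>

definition exchangeable ::
  "'a measure \<Rightarrow> 'i set \<Rightarrow> 'b measure \<Rightarrow> ('i \<Rightarrow> 'a \<Rightarrow> 'b) \<Rightarrow> bool" where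
  "exchangeable M I N \<xi> \<longleftrightarrow>
     (\<forall>i\<in>I. \<xi> i \<in> measurable M N) \<and>
     (\<forall>\<pi>. \<pi> permutes I \<longrightarrow>
        distr M (PiM I (\<lambda>_. N)) (\<lambda>\<omega>. \<lambda>i\<in>I. \<xi> (\<pi> i) \<omega>) = distr M (PiM I (\<lambda>_. N)) (\<lambda>\<omega>. \<lambda>i\<in>I. \<xi> i \<omega>))"

lemma exchangeable_measurable: "exchangeable M I N \<xi> \<Longrightarrow> i \<in> I \<Longrightarrow> \<xi> i \<in> measurable M N"
  by (simp add: exchangeable_def)

lemma exchangeable_cong:
  assumes "\<And>i \<omega>. i \<in> I \<Longrightarrow> \<xi> i \<omega> = \<zeta> i \<omega>"
  shows "exchangeable M I N \<xi> \<longleftrightarrow> exchangeable M I N \<zeta>"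
proof -
  have "\<xi> i = \<zeta> i" if "i \<in> I" for i using assms that by (simp add: fun_eq_iff)
  then show ?thesis
    unfolding exchangeable_def
    by (intro arg_cong2[of _ _ _ _ "(\<and>)"] ball_cong all_cong refl)
      (auto simp: permutes_in_image cong: restrict_cong)
qed

lemma ex_permutes_extending_inj_on:
  assumes "finite I" "J \<subseteq> I" "inj_on f J" "f ` J \<subseteq> I"
  obtains \<pi> where "\<pi> permutes I" "\<And>j. j \<in> J \<Longrightarrow> \<pi> j = f j"
proof -
  have fin: "finite (f ` J)" using assms by (auto intro: finite_subset)
  have "card (I - J) = card (I - f ` J)"
    using assms fin by (simp add: card_Diff_subset card_image finite_subset)
  then obtain g where bij_g: "bij_betw g (I - J) (I - f ` J)"
    using assms(1) by (meson finite_Diff finite_same_card_bij)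
  define \<pi> where "\<pi> x = (if x \<in> J then f x else if x \<in> I then g x else x)" for x
  have "bij_betw \<pi> J (f ` J)"
    using assms(3) by (auto simp: bij_betw_def \<pi>_def inj_on_def)
  moreover have "bij_betw \<pi> (I - J) (I - f ` J)"
    using bij_g by (subst bij_betw_cong[of _ \<pi> g]) (auto simp: \<pi>_def)
  ultimately have "bij_betw \<pi> (J \<union> (I - J)) (f ` J \<union> (I - f ` J))"
    by (rule bij_betw_combine) auto
  moreover have "J \<union> (I - J) = I" "f ` J \<union> (I - f ` J) = I" using assms by auto
  ultimately have "\<pi> permutes I"
    using assms(2) by (intro bij_imp_permutes) (auto simp: \<pi>_def)
  then show thesis using that by (auto simp: \<pi>_def)
qed

lemma exchangeable_distr_inj_on:
  assumes exch: "exchangeable M I N \<xi>" and "finite I" "J \<subseteq> I" "inj_on f J" "f ` J \<subseteq> I"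
    and meas_g: "g \<in> measurable (PiM J (\<lambda>_. N)) K"
  shows "distr M K (\<lambda>\<omega>. g (\<lambda>j\<in>J. \<xi> (f j) \<omega>)) = distr M K (\<lambda>\<omega>. g (\<lambda>j\<in>J. \<xi> j \<omega>))"
proof -
  obtain \<pi> where perm: "\<pi> permutes I" and pi_eq_f: "\<And>j. j \<in> J \<Longrightarrow> \<pi> j = f j"
    using ex_permutes_extending_inj_on[OF assms(2-5)] by blast
  let ?P = "PiM I (\<lambda>_. N)" and ?X = "\<lambda>\<pi> \<omega>. \<lambda>i\<in>I. \<xi> (\<pi> i) \<omega>"
  have g_restrict: "(\<lambda>x. g (restrict x J)) \<in> measurable ?P K"
    using measurable_compose[OF measurable_restrict_subset[OF \<open>J \<subseteq> I\<close>] meas_g] .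
  have meas_X: "?X \<rho> \<in> measurable M ?P" if "\<rho> permutes I" for \<rho>
    using that by (intro measurable_restrict exchangeable_measurable[OF exch]) (simp add: permutes_in_image)
  have "distr (distr M ?P (?X \<pi>)) K (\<lambda>x. g (restrict x J))
      = distr (distr M ?P (?X id)) K (\<lambda>x. g (restrict x J))"
    using exch perm by (simp add: exchangeable_def)
  then have "distr M K (\<lambda>\<omega>. g (\<lambda>j\<in>J. \<xi> (\<pi> j) \<omega>)) = distr M K (\<lambda>\<omega>. g (\<lambda>j\<in>J. \<xi> j \<omega>))"
    using distr_distr[OF g_restrict meas_X[OF perm]] distr_distr[OF g_restrict meas_X[OF permutes_id]]
    by (simp add: comp_def Int_absorb1[OF \<open>J \<subseteq> I\<close>])
  then show ?thesis by (simp add: pi_eq_f cong: restrict_cong)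
qed

lemma exchangeable_distr_pair:
  assumes exch: "exchangeable M I N \<xi>" and "finite I"
    and "i \<in> I" "j \<in> I" "i \<noteq> j" "p \<in> I" "q \<in> I" "p \<noteq> q"
  shows "distr M (N \<Otimes>\<^sub>M N) (\<lambda>\<omega>. (\<xi> i \<omega>, \<xi> j \<omega>)) = distr M (N \<Otimes>\<^sub>M N) (\<lambda>\<omega>. (\<xi> p \<omega>, \<xi> q \<omega>))"
proof -
  define f where "f = (\<lambda>x. if x = p then i else j)"
  have "(\<lambda>x. (x p, x q)) \<in> measurable (PiM {p, q} (\<lambda>_. N)) (N \<Otimes>\<^sub>M N)"
    by (intro measurable_Pair measurable_component_singleton) auto
  moreover have "inj_on f {p, q}" "f ` {p, q} \<subseteq> I" using assms by (auto simp: f_def inj_on_def)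
  ultimately show ?thesis
    using exchangeable_distr_inj_on[OF exch \<open>finite I\<close>, of "{p, q}" f "\<lambda>x. (x p, x q)"] assms
    by (simp add: f_def)
qed

lemma exchangeable_distr_sum:
  fixes \<xi> :: "'i \<Rightarrow> 'a \<Rightarrow> 'h::{real_normed_vector,second_countable_topology}"
  assumes exch: "exchangeable M I borel \<xi>" and "finite I" and subsets: "A \<subseteq> I" "B \<subseteq> I" "card A = card B"
  shows "distr M borel (\<lambda>\<omega>. \<Sum>i\<in>A. \<xi> i \<omega>) = distr M borel (\<lambda>\<omega>. \<Sum>i\<in>B. \<xi> i \<omega>)"
proof -
  have "finite A" "finite B" using subsets(1,2) \<open>finite I\<close> by (auto intro: finite_subset)
  then obtain f where bij_f: "bij_betw f B A"
    using finite_same_card_bij subsets(3) by metis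
  have "(\<lambda>x. \<Sum>j\<in>B. x j) \<in> borel_measurable (PiM B (\<lambda>_. borel :: 'h measure))"
    by measurable
  from exchangeable_distr_inj_on[OF exch \<open>finite I\<close> subsets(2) _ _ this, of f]
  show ?thesis
    using bij_f subsets(1) sum.reindex_bij_betw[OF bij_f, of "\<lambda>i. \<xi> i _"] by (simp add: bij_betw_def)
qed

lemma exchangeable_equivariant:
  assumes exch: "exchangeable M I N \<xi>" and "finite I"
    and meas_G: "(\<lambda>x. \<lambda>i\<in>I. G x i) \<in> measurable (PiM I (\<lambda>_. N)) (PiM I (\<lambda>_. N'))"
    and equivariant: "\<And>\<pi> x i. \<pi> permutes I \<Longrightarrow> i \<in> I \<Longrightarrow> G (\<lambda>j\<in>I. x (\<pi> j)) i = G (restrict x I) (\<pi> i)"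
  shows "exchangeable M I N' (\<lambda>i \<omega>. G (\<lambda>j\<in>I. \<xi> j \<omega>) i)"
  unfolding exchangeable_def
proof (intro conjI ballI allI impI)
  fix i assume "i \<in> I"
  have "(\<lambda>\<omega>. (\<lambda>i\<in>I. G (\<lambda>j\<in>I. \<xi> j \<omega>) i) i) \<in> measurable M N'"
    by (rule measurable_compose[OF measurable_compose[OF measurable_restrict meas_G]
          measurable_component_singleton[OF \<open>i \<in> I\<close>]]) (rule exchangeable_measurable[OF exch])
  then show "(\<lambda>\<omega>. G (\<lambda>j\<in>I. \<xi> j \<omega>) i) \<in> measurable M N'" using \<open>i \<in> I\<close> by simp
next
  fix \<pi> assume \<pi>: "\<pi> permutes I"
  then have "inj_on \<pi> I" "\<pi> ` I \<subseteq> I" by (auto simp: permutes_inj_on permutes_image)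
  from exchangeable_distr_inj_on[OF exch \<open>finite I\<close> subset_refl this meas_G]
  show "distr M (PiM I (\<lambda>_. N')) (\<lambda>\<omega>. \<lambda>i\<in>I. G (\<lambda>j\<in>I. \<xi> j \<omega>) (\<pi> i))
      = distr M (PiM I (\<lambda>_. N')) (\<lambda>\<omega>. \<lambda>i\<in>I. G (\<lambda>j\<in>I. \<xi> j \<omega>) i)"
    using equivariant[OF \<pi>, of _ "\<lambda>j. \<xi> j _"] by (simp cong: restrict_cong)
qed

lemma exchangeable_compose:
  assumes exch: "exchangeable M I N \<xi>" and "finite I" and meas_g: "g \<in> measurable N N'"
  shows "exchangeable M I N' (\<lambda>i \<omega>. g (\<xi> i \<omega>))"
proof -
  have "exchangeable M I N' (\<lambda>i \<omega>. g ((\<lambda>j\<in>I. \<xi> j \<omega>) i))"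
    by (rule exchangeable_equivariant[OF exch \<open>finite I\<close>])
      (auto simp: permutes_in_image
        intro!: measurable_restrict measurable_compose[OF _ meas_g] measurable_component_singleton)
  then show ?thesis by (simp cong: exchangeable_cong)
qed

lemma sum_sum_eq_if_off_diagonal_eq:
  fixes c g :: "'i \<Rightarrow> 'i \<Rightarrow> 'b::ab_group_add"
  assumes "finite I" and eq: "\<And>i j. i \<in> I \<Longrightarrow> j \<in> I \<Longrightarrow> i \<noteq> j \<Longrightarrow> c i j = g i j"
  shows "(\<Sum>i\<in>I. \<Sum>j\<in>I. c i j) = (\<Sum>i\<in>I. \<Sum>j\<in>I. g i j) + (\<Sum>i\<in>I. c i i - g i i)"
proof -
  have "(\<Sum>j\<in>I. c i j) = (\<Sum>j\<in>I. g i j) + (c i i - g i i)" if "i \<in> I" for i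
  proof -
    have "(\<Sum>j\<in>I - {i}. c i j) = (\<Sum>j\<in>I - {i}. g i j)"
      using that by (intro sum.cong refl eq) auto
    then show ?thesis using that \<open>finite I\<close> by (simp add: sum.remove[of I i])
  qed
  then show ?thesis by (simp add: sum.distrib)
qed

lemma power2_norm_sum:
  fixes f :: "'i \<Rightarrow> 'h::real_inner"
  shows "(norm (\<Sum>i\<in>I. f i))\<^sup>2 = (\<Sum>i\<in>I. \<Sum>j\<in>I. f i \<bullet> f j)"
  by (simp add: power2_norm_eq_inner inner_sum_left) (simp add: inner_sum_right)

lemma borel_measurable_blinfun_apply_const:
  fixes B :: "'h::{real_normed_vector,second_countable_topology} \<Rightarrow>\<^sub>L 'k::real_normed_vector"
  assumes "X \<in> borel_measurable M"
  shows "(\<lambda>\<omega>. blinfun_apply B (X \<omega>)) \<in> borel_measurable M"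
  using assms by (rule measurable_compose)
    (intro borel_measurable_continuous_onI linear_continuous_on blinfun.bounded_linear_right)

lemma abs_inner_blinfun_le:
  fixes A B :: "'h::real_normed_vector \<Rightarrow>\<^sub>L 'k::real_inner"
  assumes "norm A \<le> K" "norm B \<le> K"
  shows "\<bar>A u \<bullet> B v\<bar> \<le> K\<^sup>2 * (((norm u)\<^sup>2 + (norm v)\<^sup>2) / 2)"
proof -
  have "0 \<le> K" using order_trans[OF norm_ge_zero assms(1)] .
  have "\<bar>A u \<bullet> B v\<bar> \<le> norm (A u) * norm (B v)" by (rule Cauchy_Schwarz_ineq2)
  also have "\<dots> \<le> (K * norm u) * (K * norm v)"
    using assms \<open>0 \<le> K\<close>
    by (intro mult_mono order_trans[OF norm_blinfun] mult_right_mono mult_nonneg_nonneg) auto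
  also have "\<dots> = K\<^sup>2 * (norm u * norm v)" by (simp add: power2_eq_square)
  also have "\<dots> \<le> K\<^sup>2 * (((norm u)\<^sup>2 + (norm v)\<^sup>2) / 2)"
    using sum_squares_bound[of "norm u" "norm v"] by (intro mult_left_mono) auto
  finally show ?thesis .
qed

lemma integrable_inner_blinfun:
  fixes A B :: "'h::{real_normed_vector,second_countable_topology}
      \<Rightarrow>\<^sub>L 'k::{real_inner,second_countable_topology}"
  assumes "X \<in> borel_measurable M" "Y \<in> borel_measurable M"
    and "integrable M (\<lambda>\<omega>. (norm (X \<omega>))\<^sup>2)" "integrable M (\<lambda>\<omega>. (norm (Y \<omega>))\<^sup>2)"
  shows "integrable M (\<lambda>\<omega>. A (X \<omega>) \<bullet> B (Y \<omega>))"
proof (rule Bochner_Integration.integrable_bound)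
  let ?K = "max (norm A) (norm B)"
  show "integrable M (\<lambda>\<omega>. ?K\<^sup>2 * (((norm (X \<omega>))\<^sup>2 + (norm (Y \<omega>))\<^sup>2) / 2))"
    using assms by simp
  show "AE \<omega> in M. norm (A (X \<omega>) \<bullet> B (Y \<omega>)) \<le> norm (?K\<^sup>2 * (((norm (X \<omega>))\<^sup>2 + (norm (Y \<omega>))\<^sup>2) / 2))"
    using abs_inner_blinfun_le[of A ?K B] by (auto simp: abs_mult)
  show "(\<lambda>\<omega>. A (X \<omega>) \<bullet> B (Y \<omega>)) \<in> borel_measurable M"
    using assms by (intro borel_measurable_inner borel_measurable_blinfun_apply_const)
qed

lemma abs_integral_inner_blinfun_le:
  fixes A B :: "'h::{real_normed_vector,second_countable_topology}
      \<Rightarrow>\<^sub>L 'k::{real_inner,second_countable_topology}"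
  assumes "X \<in> borel_measurable M" "Y \<in> borel_measurable M"
    and int: "integrable M (\<lambda>\<omega>. (norm (X \<omega>))\<^sup>2)" "integrable M (\<lambda>\<omega>. (norm (Y \<omega>))\<^sup>2)"
    and "norm A \<le> K" "norm B \<le> K"
  shows "\<bar>\<integral>\<omega>. A (X \<omega>) \<bullet> B (Y \<omega>) \<partial>M\<bar> \<le> K\<^sup>2 * (((\<integral>\<omega>. (norm (X \<omega>))\<^sup>2 \<partial>M) + (\<integral>\<omega>. (norm (Y \<omega>))\<^sup>2 \<partial>M)) / 2)"
proof -
  have "\<bar>\<integral>\<omega>. A (X \<omega>) \<bullet> B (Y \<omega>) \<partial>M\<bar> \<le> (\<integral>\<omega>. \<bar>A (X \<omega>) \<bullet> B (Y \<omega>)\<bar> \<partial>M)"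
    by (rule integral_abs_bound)
  also have "\<dots> \<le> (\<integral>\<omega>. K\<^sup>2 * (((norm (X \<omega>))\<^sup>2 + (norm (Y \<omega>))\<^sup>2) / 2) \<partial>M)"
    using assms by (intro integral_mono abs_inner_blinfun_le integrable_abs integrable_inner_blinfun) auto
  also have "\<dots> = K\<^sup>2 * (((\<integral>\<omega>. (norm (X \<omega>))\<^sup>2 \<partial>M) + (\<integral>\<omega>. (norm (Y \<omega>))\<^sup>2 \<partial>M)) / 2)"
    using int by simp
  finally show ?thesis .
qed

lemma integral_sum_sum:
  fixes f :: "'i \<Rightarrow> 'j \<Rightarrow> 'a \<Rightarrow> 'b::{banach,second_countable_topology}"
  assumes "\<And>i j. i \<in> I \<Longrightarrow> j \<in> J \<Longrightarrow> integrable M (f i j)"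
  shows "(\<integral>\<omega>. (\<Sum>i\<in>I. \<Sum>j\<in>J. f i j \<omega>) \<partial>M) = (\<Sum>i\<in>I. \<Sum>j\<in>J. \<integral>\<omega>. f i j \<omega> \<partial>M)"
  using assms by (simp add: Bochner_Integration.integral_sum Bochner_Integration.integrable_sum)

lemma sum_sum_integral_inner_blinfun:
  fixes A :: "'i \<Rightarrow> 'h::{real_normed_vector,second_countable_topology}
      \<Rightarrow>\<^sub>L 'k::{real_inner,second_countable_topology}"
    and B :: "'j \<Rightarrow> 'h \<Rightarrow>\<^sub>L 'k"
  assumes "X \<in> borel_measurable M" "Y \<in> borel_measurable M"
    and "integrable M (\<lambda>\<omega>. (norm (X \<omega>))\<^sup>2)" "integrable M (\<lambda>\<omega>. (norm (Y \<omega>))\<^sup>2)"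
  shows "(\<Sum>i\<in>I. \<Sum>j\<in>J. \<integral>\<omega>. A i (X \<omega>) \<bullet> B j (Y \<omega>) \<partial>M)
    = (\<integral>\<omega>. blinfun_apply (\<Sum>i\<in>I. A i) (X \<omega>) \<bullet> blinfun_apply (\<Sum>j\<in>J. B j) (Y \<omega>) \<partial>M)"
proof -
  have "(\<Sum>i\<in>I. \<Sum>j\<in>J. \<integral>\<omega>. A i (X \<omega>) \<bullet> B j (Y \<omega>) \<partial>M) = (\<integral>\<omega>. (\<Sum>i\<in>I. \<Sum>j\<in>J. A i (X \<omega>) \<bullet> B j (Y \<omega>)) \<partial>M)"
    using assms by (intro integral_sum_sum[symmetric] integrable_inner_blinfun)
  also have "(\<lambda>\<omega>. \<Sum>i\<in>I. \<Sum>j\<in>J. A i (X \<omega>) \<bullet> B j (Y \<omega>))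
      = (\<lambda>\<omega>. blinfun_apply (\<Sum>i\<in>I. A i) (X \<omega>) \<bullet> blinfun_apply (\<Sum>j\<in>J. B j) (Y \<omega>))"
    by (simp add: blinfun.sum_left inner_sum_left) (simp add: inner_sum_right)
  finally show ?thesis .
qed

lemma exchangeable_integral_pair:
  fixes h :: "'b \<times> 'b \<Rightarrow> real"
  assumes exch: "exchangeable M I N \<xi>" and "finite I"
    and "i \<in> I" "j \<in> I" "i \<noteq> j" "p \<in> I" "q \<in> I" "p \<noteq> q" and "h \<in> borel_measurable (N \<Otimes>\<^sub>M N)"
  shows "(\<integral>\<omega>. h (\<xi> i \<omega>, \<xi> j \<omega>) \<partial>M) = (\<integral>\<omega>. h (\<xi> p \<omega>, \<xi> q \<omega>) \<partial>M)"
proof -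
  have "(\<lambda>\<omega>. (\<xi> i \<omega>, \<xi> j \<omega>)) \<in> measurable M (N \<Otimes>\<^sub>M N)" if "i \<in> I" "j \<in> I" for i j
    using that by (intro measurable_Pair exchangeable_measurable[OF exch])
  then show ?thesis
    using arg_cong[OF exchangeable_distr_pair[OF assms(1-8)], of "\<lambda>\<mu>. integral\<^sup>L \<mu> h"] assms
    by (simp add: integral_distr)
qed

lemma exchangeable_integral_inner_blinfun_eq:
  fixes y :: "'i \<Rightarrow> 'a \<Rightarrow> 'h::{real_normed_vector,second_countable_topology}"
    and A B :: "'h \<Rightarrow>\<^sub>L 'k::{real_inner,second_countable_topology}"
  assumes "exchangeable M I borel y" "finite I"
    and "i \<in> I" "j \<in> I" "i \<noteq> j" "p \<in> I" "q \<in> I" "p \<noteq> q"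
  shows "(\<integral>\<omega>. A (y i \<omega>) \<bullet> B (y j \<omega>) \<partial>M) = (\<integral>\<omega>. A (y p \<omega>) \<bullet> B (y q \<omega>) \<partial>M)"
proof -
  have "(\<lambda>z. A (fst z) \<bullet> B (snd z)) \<in> borel_measurable (borel \<Otimes>\<^sub>M borel)"
    by (intro borel_measurable_inner borel_measurable_blinfun_apply_const) auto
  from exchangeable_integral_pair[OF assms this] show ?thesis by simp
qed

text \<open>Off the diagonal the covariances agree with those of one fixed pair \<open>y p, y q\<close>,
  and these add up to 0.\<close>

lemma exchangeable_second_moment_centred_sum_le:
  fixes y :: "'i \<Rightarrow> 'a \<Rightarrow> 'h::{real_inner,second_countable_topology}"
    and \<Psi> :: "'i \<Rightarrow> 'h \<Rightarrow>\<^sub>L 'k::{real_inner,second_countable_topology}"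
  assumes exch: "exchangeable M I borel y" and finite_I: "finite I"
    and int: "\<And>i. i \<in> I \<Longrightarrow> integrable M (\<lambda>\<omega>. (norm (y i \<omega>))\<^sup>2)"
    and bound: "\<And>i. i \<in> I \<Longrightarrow> norm (\<Psi> i) \<le> K" and centred: "(\<Sum>i\<in>I. \<Psi> i) = 0"
  shows "(\<integral>\<omega>. (norm (\<Sum>i\<in>I. \<Psi> i (y i \<omega>)))\<^sup>2 \<partial>M) \<le> 2 * K\<^sup>2 * (\<Sum>i\<in>I. \<integral>\<omega>. (norm (y i \<omega>))\<^sup>2 \<partial>M)"
proof (cases "\<exists>p\<in>I. \<exists>q\<in>I. p \<noteq> q")
  case False
  then consider "I = {}" | p where "I = {p}" by (cases "I = {}") auto
  then show ?thesis using centred by cases auto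
next
  case True
  then obtain p q where pq: "p \<in> I" "q \<in> I" "p \<noteq> q" by blast
  note meas [measurable] = exchangeable_measurable[OF exch]
  define v where "v i = (\<integral>\<omega>. (norm (y i \<omega>))\<^sup>2 \<partial>M)" for i
  define c where "c i j = (\<integral>\<omega>. \<Psi> i (y i \<omega>) \<bullet> \<Psi> j (y j \<omega>) \<partial>M)" for i j
  define g where "g i j = (\<integral>\<omega>. \<Psi> i (y p \<omega>) \<bullet> \<Psi> j (y q \<omega>) \<partial>M)" for i j
  have int_inner: "integrable M (\<lambda>\<omega>. \<Psi> i (y k \<omega>) \<bullet> \<Psi> j (y l \<omega>))" if "k \<in> I" "l \<in> I" for i j k l
    using that by (intro integrable_inner_blinfun meas int)
  have c_eq_g: "c i j = g i j" if "i \<in> I" "j \<in> I" "i \<noteq> j" for i j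
    unfolding c_def g_def by (rule exchangeable_integral_inner_blinfun_eq[OF exch finite_I that pq])
  have v_eq: "v i = v p" if "i \<in> I" for i
  proof -
    obtain j where "j \<in> I" "i \<noteq> j" using pq by metis
    from exchangeable_integral_pair[OF exch finite_I that this pq, of "\<lambda>(u, w). (norm u)\<^sup>2"]
    show ?thesis by (simp add: v_def case_prod_beta)
  qed
  have abs_le: "\<bar>\<integral>\<omega>. \<Psi> i (y k \<omega>) \<bullet> \<Psi> i (y l \<omega>) \<partial>M\<bar> \<le> K\<^sup>2 * v p" if "i \<in> I" "k \<in> I" "l \<in> I" for i k l
    using abs_integral_inner_blinfun_le[OF meas meas int int bound bound, of k l i i] that v_eq
    by (simp add: v_def)
  have sum_g: "(\<Sum>i\<in>I. \<Sum>j\<in>I. g i j) = 0"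
    unfolding g_def using pq by (simp add: sum_sum_integral_inner_blinfun meas int centred)
  have "(\<integral>\<omega>. (norm (\<Sum>i\<in>I. \<Psi> i (y i \<omega>)))\<^sup>2 \<partial>M) = (\<Sum>i\<in>I. \<Sum>j\<in>I. c i j)"
    unfolding c_def by (simp add: power2_norm_sum integral_sum_sum int_inner)
  also have "\<dots> = (\<Sum>i\<in>I. c i i - g i i)"
    using sum_sum_eq_if_off_diagonal_eq[OF finite_I, of c g] c_eq_g by (simp add: sum_g)
  also have "\<dots> \<le> (\<Sum>i\<in>I. 2 * K\<^sup>2 * v i)"
  proof (rule sum_mono)
    fix i assume "i \<in> I"
    then show "c i i - g i i \<le> 2 * K\<^sup>2 * v i"
      using abs_le[of i i i] abs_le[of i p q] pq v_eq[of i] by (simp add: c_def g_def)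
  qed
  finally show ?thesis by (simp add: v_def sum_distrib_left)
qed

lemma exchangeable_truncation:
  fixes \<xi> :: "'i \<Rightarrow> 'a \<Rightarrow> 'h::{real_normed_vector,second_countable_topology}"
  assumes exch: "exchangeable M I borel \<xi>" and finite_I: "finite I"
  shows "exchangeable M I borel (\<lambda>i \<omega>. if (\<Sum>k\<in>I. (norm (\<xi> k \<omega>))\<^sup>2) \<le> \<kappa> then \<xi> i \<omega> else 0)"
proof -
  define G where "G x i = (if (\<Sum>k\<in>I. (norm (x k))\<^sup>2) \<le> \<kappa> then x i else 0)" for x :: "'i \<Rightarrow> 'h" and i
  have "exchangeable M I borel (\<lambda>i \<omega>. G (\<lambda>j\<in>I. \<xi> j \<omega>) i)"
  proof (rule exchangeable_equivariant[OF exch finite_I])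
    have [measurable]: "(\<lambda>x. x k) \<in> borel_measurable (PiM I (\<lambda>_. borel :: 'h measure))" if "k \<in> I" for k
      using that by (rule measurable_component_singleton)
    show "(\<lambda>x. \<lambda>i\<in>I. G x i) \<in> measurable (PiM I (\<lambda>_. borel)) (PiM I (\<lambda>_. borel))"
      unfolding G_def by measurable
    fix \<pi> x i assume "\<pi> permutes I" "i \<in> I"
    then show "G (\<lambda>j\<in>I. x (\<pi> j)) i = G (restrict x I) (\<pi> i)"
      using sum.permute[of \<pi> I "\<lambda>k. (norm (x k))\<^sup>2"] by (simp add: G_def permutes_in_image comp_def)
  qed
  moreover have "G (\<lambda>j\<in>I. \<xi> j \<omega>) i = (if (\<Sum>k\<in>I. (norm (\<xi> k \<omega>))\<^sup>2) \<le> \<kappa> then \<xi> i \<omega> else 0)" if "i \<in> I" for i \<omega>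
    using that by (simp add: G_def)
  ultimately show ?thesis by (simp cong: exchangeable_cong)
qed

lemma (in prob_space) exchangeable_prob_centred_sum_le_if_bounded:
  fixes y :: "'i \<Rightarrow> 'a \<Rightarrow> 'h::{real_inner,second_countable_topology}"
    and \<Psi> :: "'i \<Rightarrow> 'h \<Rightarrow>\<^sub>L 'k::{real_inner,second_countable_topology}"
  assumes exch: "exchangeable M I borel y" and finite_I: "finite I" and "0 < \<delta>"
    and sum_y: "\<And>\<omega>. (\<Sum>i\<in>I. (norm (y i \<omega>))\<^sup>2) \<le> \<kappa>"
    and bound: "\<And>i. i \<in> I \<Longrightarrow> norm (\<Psi> i) \<le> K" and centred: "(\<Sum>i\<in>I. \<Psi> i) = 0"
  shows "prob {\<omega>\<in>space M. \<delta> \<le> norm (\<Sum>i\<in>I. \<Psi> i (y i \<omega>))} \<le> 2 * K\<^sup>2 * \<kappa> / \<delta>\<^sup>2"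
proof -
  note [measurable] = exchangeable_measurable[OF exch]
  have int: "integrable M (\<lambda>\<omega>. (norm (y i \<omega>))\<^sup>2)" if "i \<in> I" for i
    using member_le_sum[OF that, of "\<lambda>i. (norm (y i _))\<^sup>2"] sum_y finite_I that
    by (intro integrable_const_bound[where B = \<kappa>] AE_I2) (auto intro: order_trans)
  let ?S = "\<lambda>\<omega>. (norm (\<Sum>i\<in>I. \<Psi> i (y i \<omega>)))\<^sup>2"
  have int_S: "integrable M ?S"
    unfolding power2_norm_sum
    by (intro Bochner_Integration.integrable_sum integrable_inner_blinfun int) auto
  have "expectation ?S \<le> 2 * K\<^sup>2 * (\<Sum>i\<in>I. expectation (\<lambda>\<omega>. (norm (y i \<omega>))\<^sup>2))"
    by (rule exchangeable_second_moment_centred_sum_le[OF exch finite_I int bound centred])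
  also have "\<dots> = 2 * K\<^sup>2 * expectation (\<lambda>\<omega>. \<Sum>i\<in>I. (norm (y i \<omega>))\<^sup>2)"
    by (simp add: Bochner_Integration.integral_sum int)
  also have "\<dots> \<le> 2 * K\<^sup>2 * \<kappa>"
    using sum_y by (intro mult_left_mono integral_le_const Bochner_Integration.integrable_sum int) auto
  finally have E_S: "expectation ?S \<le> 2 * K\<^sup>2 * \<kappa>" .
  have "prob {\<omega>\<in>space M. \<delta> \<le> norm (\<Sum>i\<in>I. \<Psi> i (y i \<omega>))} = prob {\<omega>\<in>space M. \<delta>\<^sup>2 \<le> ?S \<omega>}"
    using \<open>0 < \<delta>\<close> by (simp add: power_mono_iff)
  also have "\<dots> \<le> expectation ?S / \<delta>\<^sup>2"
    using \<open>0 < \<delta>\<close> by (intro integral_Markov_inequality_measure[where A = "{}"] int_S) auto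
  also have "\<dots> \<le> 2 * K\<^sup>2 * \<kappa> / \<delta>\<^sup>2" using E_S by (intro divide_right_mono) auto
  finally show ?thesis .
qed

lemma (in prob_space) exchangeable_prob_centred_sum_le:
  fixes \<xi> :: "'i \<Rightarrow> 'a \<Rightarrow> 'h::{real_inner,second_countable_topology}"
    and \<Psi> :: "'i \<Rightarrow> 'h \<Rightarrow>\<^sub>L 'k::{real_inner,second_countable_topology}"
  assumes exch: "exchangeable M I borel \<xi>" and finite_I: "finite I" and "0 < \<delta>" "0 \<le> \<kappa>"
    and bound: "\<And>i. i \<in> I \<Longrightarrow> norm (\<Psi> i) \<le> K" and centred: "(\<Sum>i\<in>I. \<Psi> i) = 0"
  shows "prob {\<omega>\<in>space M. \<delta> < norm (\<Sum>i\<in>I. \<Psi> i (\<xi> i \<omega>))}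
    \<le> prob {\<omega>\<in>space M. \<kappa> < (\<Sum>i\<in>I. (norm (\<xi> i \<omega>))\<^sup>2)} + 2 * K\<^sup>2 * \<kappa> / \<delta>\<^sup>2"
proof -
  define y where "y i \<omega> = (if (\<Sum>k\<in>I. (norm (\<xi> k \<omega>))\<^sup>2) \<le> \<kappa> then \<xi> i \<omega> else 0)" for i \<omega>
  have exch_y: "exchangeable M I borel y"
    unfolding y_def by (rule exchangeable_truncation[OF exch finite_I])
  note [measurable] = exchangeable_measurable[OF exch] exchangeable_measurable[OF exch_y]
  have [measurable]: "(\<lambda>\<omega>. \<Sum>i\<in>I. \<Psi> i (y i \<omega>)) \<in> borel_measurable M"
    by (intro borel_measurable_sum borel_measurable_blinfun_apply_const) measurable
  have sum_y: "(\<Sum>i\<in>I. (norm (y i \<omega>))\<^sup>2) \<le> \<kappa>" for \<omega>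
    using \<open>0 \<le> \<kappa>\<close> by (cases "(\<Sum>k\<in>I. (norm (\<xi> k \<omega>))\<^sup>2) \<le> \<kappa>") (simp_all add: y_def)
  let ?A = "{\<omega>\<in>space M. \<delta> < norm (\<Sum>i\<in>I. \<Psi> i (\<xi> i \<omega>))}"
  let ?B = "{\<omega>\<in>space M. \<kappa> < (\<Sum>i\<in>I. (norm (\<xi> i \<omega>))\<^sup>2)}"
  let ?C = "{\<omega>\<in>space M. \<delta> \<le> norm (\<Sum>i\<in>I. \<Psi> i (y i \<omega>))}"
  have "\<omega> \<in> ?B \<union> ?C" if "\<omega> \<in> ?A" for \<omega>
    using that by (cases "(\<Sum>i\<in>I. (norm (\<xi> i \<omega>))\<^sup>2) \<le> \<kappa>") (simp_all add: y_def)
  then have "prob ?A \<le> prob (?B \<union> ?C)" by (intro finite_measure_mono subsetI) measurable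
  also have "\<dots> \<le> prob ?B + prob ?C" by (intro measure_Un_le) measurable
  also have "prob ?C \<le> 2 * K\<^sup>2 * \<kappa> / \<delta>\<^sup>2"
    by (rule exchangeable_prob_centred_sum_le_if_bounded[OF exch_y finite_I \<open>0 < \<delta>\<close> sum_y bound centred])
  finally show ?thesis by simp
qed

lemma ex_mean_norm_le:
  fixes \<Phi> :: "'i \<Rightarrow> 'b::real_normed_vector"
  assumes "finite I" "I \<noteq> {}" and bound: "\<And>i. i \<in> I \<Longrightarrow> norm (\<Phi> i) \<le> K"
  obtains T where "norm T \<le> K" "(\<Sum>i\<in>I. \<Phi> i - T) = 0"
proof
  let ?T = "(1 / real (card I)) *\<^sub>R (\<Sum>i\<in>I. \<Phi> i)"
  have card: "0 < real (card I)" using assms by (simp add: card_gt_0_iff)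
  have "norm (\<Sum>i\<in>I. \<Phi> i) \<le> real (card I) * K" using bound by (rule sum_norm_bound)
  then show "norm ?T \<le> K" using card by (simp add: field_simps)
  show "(\<Sum>i\<in>I. \<Phi> i - ?T) = 0" using card by (simp add: sum_subtractf sum_constant_scaleR)
qed

lemma norm_sum_blinfun_le_centred:
  fixes \<Phi> :: "'i \<Rightarrow> 'h::real_normed_vector \<Rightarrow>\<^sub>L 'k::real_normed_vector"
  assumes "norm T \<le> K"
  shows "norm (\<Sum>i\<in>I. \<Phi> i (x i)) \<le> norm (\<Sum>i\<in>I. blinfun_apply (\<Phi> i - T) (x i)) + K * norm (\<Sum>i\<in>I. x i)"
proof -
  have split: "(\<Sum>i\<in>I. \<Phi> i (x i)) = (\<Sum>i\<in>I. blinfun_apply (\<Phi> i - T) (x i)) + T (\<Sum>i\<in>I. x i)"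
    by (simp add: blinfun.diff_left sum_subtractf blinfun.sum_right)
  have "norm (T (\<Sum>i\<in>I. x i)) \<le> K * norm (\<Sum>i\<in>I. x i)"
    using assms by (intro order_trans[OF norm_blinfun] mult_right_mono) auto
  then show ?thesis unfolding split by (intro norm_triangle_mono order_refl)
qed

lemma (in prob_space) exchangeable_prob_operator_sum_le:
  fixes \<xi> :: "'i \<Rightarrow> 'a \<Rightarrow> 'h::{real_inner,second_countable_topology}"
    and \<Phi> :: "'i \<Rightarrow> 'h \<Rightarrow>\<^sub>L 'k::{real_inner,second_countable_topology}"
  assumes exch: "exchangeable M I borel \<xi>" and finite_I: "finite I" and "0 < \<eta>" "0 < \<epsilon>" "0 \<le> K" "2 * K * \<eta> \<le> \<epsilon>"
    and small: "\<And>A. A \<subseteq> I \<Longrightarrow> close_in_prob M \<eta> (\<lambda>\<omega>. \<Sum>i\<in>A. \<xi> i \<omega>) (\<lambda>_. 0)"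
    and bound: "\<And>i. i \<in> I \<Longrightarrow> norm (\<Phi> i) \<le> K"
  shows "prob {\<omega>\<in>space M. \<epsilon> < norm (\<Sum>i\<in>I. \<Phi> i (\<xi> i \<omega>))} \<le> 25 * \<eta> + 256 * K\<^sup>2 * \<eta>\<^sup>2 / \<epsilon>\<^sup>2"
proof (cases "I = {}")
  case True
  then show ?thesis using \<open>0 < \<eta>\<close> \<open>0 < \<epsilon>\<close> by simp
next
  case False
  note meas [measurable] = exchangeable_measurable[OF exch]
  obtain T where norm_T: "norm T \<le> K" and centred: "(\<Sum>i\<in>I. \<Phi> i - T) = 0"
    using ex_mean_norm_le[OF finite_I False bound] .
  have \<Phi>_T_bound: "norm (\<Phi> i - T) \<le> 2 * K" if "i \<in> I" for i
    using norm_triangle_ineq4[of "\<Phi> i" T] bound[OF that] norm_T by linarith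
  let ?\<Psi>\<xi> = "\<lambda>\<omega>. \<Sum>i\<in>I. blinfun_apply (\<Phi> i - T) (\<xi> i \<omega>)"
  have [measurable]: "?\<Psi>\<xi> \<in> borel_measurable M"
    by (intro borel_measurable_sum borel_measurable_blinfun_apply_const meas)
  have "prob {\<omega>\<in>space M. \<epsilon> / 2 < K * norm (\<Sum>i\<in>I. \<xi> i \<omega>)} \<le> prob {\<omega>\<in>space M. \<eta> < norm (\<Sum>i\<in>I. \<xi> i \<omega>)}"
  proof (rule finite_measure_mono)
    have "K * norm x \<le> \<epsilon> / 2" if "norm x \<le> \<eta>" for x :: 'h
      using mult_left_mono[OF that \<open>0 \<le> K\<close>] \<open>2 * K * \<eta> \<le> \<epsilon>\<close> by linarith
    then show "{\<omega>\<in>space M. \<epsilon> / 2 < K * norm (\<Sum>i\<in>I. \<xi> i \<omega>)} \<subseteq> {\<omega>\<in>space M. \<eta> < norm (\<Sum>i\<in>I. \<xi> i \<omega>)}"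
      by (auto simp: not_le[symmetric])
  qed measurable
  also have "\<dots> \<le> \<eta>" using small[of I] by (simp add: close_in_prob_def)
  finally have mean_part: "prob {\<omega>\<in>space M. \<epsilon> / 2 < K * norm (\<Sum>i\<in>I. \<xi> i \<omega>)} \<le> \<eta>" .
  have "prob {\<omega>\<in>space M. \<epsilon> / 2 < norm (?\<Psi>\<xi> \<omega>)}
    \<le> prob {\<omega>\<in>space M. 8 * \<eta>\<^sup>2 < (\<Sum>i\<in>I. (norm (\<xi> i \<omega>))\<^sup>2)} + 2 * (2 * K)\<^sup>2 * (8 * \<eta>\<^sup>2) / (\<epsilon> / 2)\<^sup>2"
    using \<open>0 < \<epsilon>\<close> by (intro exchangeable_prob_centred_sum_le[OF exch finite_I _ _ \<Phi>_T_bound centred]) auto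
  also have "prob {\<omega>\<in>space M. 8 * \<eta>\<^sup>2 < (\<Sum>i\<in>I. (norm (\<xi> i \<omega>))\<^sup>2)} \<le> 24 * \<eta>"
    by (rule prob_sum_power2_norm_le[OF finite_I meas \<open>0 < \<eta>\<close> small])
  finally have centred_part: "prob {\<omega>\<in>space M. \<epsilon> / 2 < norm (?\<Psi>\<xi> \<omega>)} \<le> 24 * \<eta> + 256 * K\<^sup>2 * \<eta>\<^sup>2 / \<epsilon>\<^sup>2"
    by (simp add: power_mult_distrib power_divide)
  have "prob {\<omega>\<in>space M. \<epsilon> / 2 + \<epsilon> / 2 < norm (\<Sum>i\<in>I. \<Phi> i (\<xi> i \<omega>))}
    \<le> prob {\<omega>\<in>space M. \<epsilon> / 2 < norm (?\<Psi>\<xi> \<omega>)} + prob {\<omega>\<in>space M. \<epsilon> / 2 < K * norm (\<Sum>i\<in>I. \<xi> i \<omega>)}"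
    by (intro measure_add_less_le norm_sum_blinfun_le_centred norm_T) measurable
  then show ?thesis using centred_part mean_part by simp
qed

lemma (in prob_space) ex_close_in_prob_exchangeable_operator_sum:
  assumes "0 < \<epsilon>" "0 \<le> K"
  obtains \<eta> where "0 < \<eta>"
    "\<And>(I :: 'i set) (\<xi> :: 'i \<Rightarrow> 'a \<Rightarrow> 'h::{real_inner,second_countable_topology})
       (\<Phi> :: 'i \<Rightarrow> 'h \<Rightarrow>\<^sub>L 'k::{real_inner,second_countable_topology}).
       finite I \<Longrightarrow> exchangeable M I borel \<xi> \<Longrightarrow>
       (\<And>A. A \<subseteq> I \<Longrightarrow> close_in_prob M \<eta> (\<lambda>\<omega>. \<Sum>i\<in>A. \<xi> i \<omega>) (\<lambda>_. 0)) \<Longrightarrow>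
       (\<And>i. i \<in> I \<Longrightarrow> norm (\<Phi> i) \<le> K) \<Longrightarrow>
       close_in_prob M \<epsilon> (\<lambda>\<omega>. \<Sum>i\<in>I. blinfun_apply (\<Phi> i) (\<xi> i \<omega>)) (\<lambda>_. 0)"
proof -
  have "((\<lambda>\<eta>. 25 * \<eta> + 256 * K\<^sup>2 * \<eta>\<^sup>2 / \<epsilon>\<^sup>2) \<longlongrightarrow> 25 * 0 + 256 * K\<^sup>2 * 0\<^sup>2 / \<epsilon>\<^sup>2) (at_right 0)"
    "((\<lambda>\<eta>. 2 * K * \<eta>) \<longlongrightarrow> 2 * K * 0) (at_right 0)"
    using \<open>0 < \<epsilon>\<close> by (intro tendsto_intros; simp)+
  then have "eventually (\<lambda>\<eta>. 25 * \<eta> + 256 * K\<^sup>2 * \<eta>\<^sup>2 / \<epsilon>\<^sup>2 < \<epsilon>) (at_right 0)"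
    "eventually (\<lambda>\<eta>. 2 * K * \<eta> < \<epsilon>) (at_right 0)"
    using \<open>0 < \<epsilon>\<close> by (auto intro: order_tendstoD(2))
  then have "eventually (\<lambda>\<eta>. 0 < \<eta> \<and> 25 * \<eta> + 256 * K\<^sup>2 * \<eta>\<^sup>2 / \<epsilon>\<^sup>2 < \<epsilon> \<and> 2 * K * \<eta> < \<epsilon>) (at_right 0)"
    using eventually_at_right_less[of 0] by eventually_elim simp
  then obtain \<eta> where \<eta>: "0 < \<eta>" "25 * \<eta> + 256 * K\<^sup>2 * \<eta>\<^sup>2 / \<epsilon>\<^sup>2 < \<epsilon>" "2 * K * \<eta> < \<epsilon>"
    using eventually_happens'[OF trivial_limit_at_right_real] by blast
  show thesis
  proof
    fix I :: "'i set" and \<xi> :: "'i \<Rightarrow> 'a \<Rightarrow> 'h" and \<Phi> :: "'i \<Rightarrow> 'h \<Rightarrow>\<^sub>L 'k"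
    assume "finite I" "exchangeable M I borel \<xi>"
      and small: "\<And>A. A \<subseteq> I \<Longrightarrow> close_in_prob M \<eta> (\<lambda>\<omega>. \<Sum>i\<in>A. \<xi> i \<omega>) (\<lambda>_. 0)"
      and bound: "\<And>i. i \<in> I \<Longrightarrow> norm (\<Phi> i) \<le> K"
    have "prob {\<omega>\<in>space M. \<epsilon> < norm (\<Sum>i\<in>I. \<Phi> i (\<xi> i \<omega>))} \<le> 25 * \<eta> + 256 * K\<^sup>2 * \<eta>\<^sup>2 / \<epsilon>\<^sup>2"
      by (rule exchangeable_prob_operator_sum_le[OF \<open>exchangeable M I borel \<xi>\<close> \<open>finite I\<close>
            \<eta>(1) \<open>0 < \<epsilon>\<close> \<open>0 \<le> K\<close> less_imp_le[OF \<eta>(3)] small bound])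
    then show "close_in_prob M \<epsilon> (\<lambda>\<omega>. \<Sum>i\<in>I. \<Phi> i (\<xi> i \<omega>)) (\<lambda>_. 0)"
      using \<eta>(2) by (simp add: close_in_prob_def)
  qed (rule \<eta>(1))
qed

section \<open>Finite-rank approximation of the identity\<close>

text \<open>Gram--Schmidt in operator form: \<open>deflation d n\<close> is the orthogonal projection onto the complement
  of \<open>d 0, \<dots>, d (n - 1)\<close>.\<close>

primrec deflation :: "(nat \<Rightarrow> 'h::real_inner) \<Rightarrow> nat \<Rightarrow> 'h \<Rightarrow>\<^sub>L 'h" where
  "deflation d 0 = id_blinfun"
| "deflation d (Suc n) = deflation d n
     - (blinfun_scaleR_left (sgn (deflation d n (d n))) o\<^sub>L
        blinfun_inner_right (sgn (deflation d n (d n))) o\<^sub>L deflation d n)"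

lemma norm_diff_projection_le:
  fixes u v :: "'h::real_inner"
  assumes "norm u \<le> 1"
  shows "norm (v - (u \<bullet> v) *\<^sub>R u) \<le> norm v"
proof (rule power2_le_imp_le)
  have "u \<bullet> u \<le> 1" using assms by (simp add: abs_square_le_1 flip: power2_norm_eq_inner)
  then have "(u \<bullet> v)\<^sup>2 * (u \<bullet> u) \<le> (u \<bullet> v)\<^sup>2" by (simp add: mult_left_le)
  moreover have "(norm (v - (u \<bullet> v) *\<^sub>R u))\<^sup>2 = (norm v)\<^sup>2 - 2 * (u \<bullet> v)\<^sup>2 + (u \<bullet> v)\<^sup>2 * (u \<bullet> u)"
    unfolding power2_norm_eq_inner
    by (simp add: inner_diff_left inner_diff_right inner_commute power2_eq_square algebra_simps)
  ultimately show "(norm (v - (u \<bullet> v) *\<^sub>R u))\<^sup>2 \<le> (norm v)\<^sup>2"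
    using zero_le_power2[of "u \<bullet> v"] by linarith
qed simp

lemma norm_deflation_le: "norm (deflation d n x) \<le> norm x"
proof (induction n)
  case (Suc n)
  have "norm (sgn (deflation d n (d n))) \<le> 1" by (simp add: norm_sgn)
  then have "norm (deflation d (Suc n) x) \<le> norm (deflation d n x)"
    by (simp add: blinfun.diff_left norm_diff_projection_le)
  then show ?case using Suc by (rule order_trans)
qed simp

lemma deflation_eq_0: "n < m \<Longrightarrow> deflation d m (d n) = 0"
proof (induction m)
  case (Suc m)
  show ?case
  proof (cases "n < m")
    case True
    then show ?thesis using Suc.IH by (simp add: blinfun.diff_left)
  next
    case False
    with Suc.prems have "m = n" by simp
    moreover have "w - (sgn w \<bullet> w) *\<^sub>R sgn w = 0" for w :: 'a
      by (cases "w = 0")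
        (simp_all add: sgn_div_norm power2_norm_eq_inner[symmetric] power2_eq_square field_simps)
    ultimately show ?thesis by (simp add: blinfun.diff_left)
  qed
qed simp

lemma deflation_tendsto_0:
  assumes "closure (range d) = UNIV"
  shows "(\<lambda>n. deflation d n x) \<longlonglongrightarrow> 0"
proof (rule LIMSEQ_I)
  fix \<epsilon> :: real assume "0 < \<epsilon>"
  then obtain k where near_d_k: "norm (x - d k) < \<epsilon>"
    using assms closure_approachable[of x "range d"] by (auto simp: dist_norm norm_minus_commute)
  have "norm (deflation d n x) < \<epsilon>" if "Suc k \<le> n" for n
  proof -
    have "deflation d n x = deflation d n (x - d k)"
      using deflation_eq_0[of k n d] that by (simp add: blinfun.diff_right)
    then show ?thesis using norm_deflation_le[of d n "x - d k"] near_d_k by simp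
  qed
  then show "\<exists>N. \<forall>n\<ge>N. norm (deflation d n x - 0) < \<epsilon>" by auto
qed

text \<open>\<open>id - deflation d n\<close> has finite rank, and composing with a finite-rank operator turns strong
  continuity into continuity in the operator norm.\<close>

lemma continuous_on_blinfun_compose_id_minus_deflation:
  fixes G :: "'s::topological_space \<Rightarrow> 'h::real_inner \<Rightarrow>\<^sub>L 'k::real_normed_vector"
  assumes "\<And>x. continuous_on S (\<lambda>s. G s x)"
  shows "continuous_on S (\<lambda>s. G s o\<^sub>L (id_blinfun - deflation d n))"
proof (induction n)
  case (Suc n)
  define u where "u = sgn (deflation d n (d n))"
  have split: "(G s o\<^sub>L (id_blinfun - deflation d (Suc n))) = (G s o\<^sub>L (id_blinfun - deflation d n))
      + (blinfun_scaleR_left (G s u) o\<^sub>L (blinfun_inner_right u o\<^sub>L deflation d n))" for s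
    by (rule blinfun_eqI)
      (simp add: u_def blinfun.diff_left blinfun.add_left blinfun.diff_right blinfun.add_right
        blinfun.scaleR_right)
  show ?case
    unfolding split
    by (intro continuous_on_add Suc bounded_bilinear.continuous_on[OF bounded_bilinear_blinfun_compose]
        bounded_linear.continuous_on[OF bounded_linear_blinfun_scaleR_left] assms continuous_on_const)
qed (simp add: continuous_on_const)

lemma ex_dense_sequence:
  obtains d :: "nat \<Rightarrow> 'h::second_countable_topology" where "closure (range d) = UNIV"
proof -
  obtain D :: "'h set" where dense: "countable D" "\<And>X. open X \<Longrightarrow> X \<noteq> {} \<Longrightarrow> \<exists>d\<in>D. d \<in> X"
    using countable_dense_setE by blast
  have "D \<noteq> {}" using dense(2)[of UNIV] by auto
  moreover have "closure D = UNIV"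
    using dense(2)[of "- closure D"] closure_subset[of D] by (auto simp: open_Compl)
  ultimately show thesis using that[of "from_nat_into D"] range_from_nat_into[OF _ dense(1)] by simp
qed

section \<open>Processes with stationary independent increments\<close>

lemma (in prob_space) distr_indep_vars_reindex:
  assumes indep: "indep_vars (\<lambda>_. N) X I" and law: "\<And>i. i \<in> I \<Longrightarrow> distr M N (X i) = D"
    and inj_f: "inj_on f J" "f ` J \<subseteq> I" and "J \<noteq> {}"
  shows "distr M (PiM J (\<lambda>_. N)) (\<lambda>\<omega>. \<lambda>j\<in>J. X (f j) \<omega>) = PiM J (\<lambda>_. D)"
proof -
  have meas: "X i \<in> measurable M N" if "i \<in> I" for i
    using indep that by (simp add: indep_vars_def)
  have "I \<noteq> {}" using inj_f(2) \<open>J \<noteq> {}\<close> by auto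
  then obtain i where "i \<in> I" by blast
  then have D_law: "prob_space D" "sets D = sets N"
    using prob_space_distr[OF meas] law by (metis, metis sets_distr)
  have joint: "distr M (PiM I (\<lambda>_. N)) (\<lambda>\<omega>. \<lambda>i\<in>I. X i \<omega>) = PiM I (\<lambda>_. D)"
    using indep indep_vars_iff_distr_eq_PiM'[where M' = "\<lambda>_. N" and X = X, OF \<open>I \<noteq> {}\<close> meas] law
    by (simp cong: PiM_cong)
  have meas_X: "(\<lambda>\<omega>. \<lambda>i\<in>I. X i \<omega>) \<in> measurable M (PiM I (\<lambda>_. N))"
    by (intro measurable_restrict meas)
  have reindex: "(\<lambda>x. \<lambda>j\<in>J. x (f j)) \<in> measurable (PiM I (\<lambda>_. N)) (PiM J (\<lambda>_. N))"
    using inj_f(2) by (intro measurable_restrict measurable_component_singleton) auto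
  have "PiM J (\<lambda>_. D) = distr (PiM I (\<lambda>_. D)) (PiM J (\<lambda>_. D)) (\<lambda>x. \<lambda>j\<in>J. x (f j))"
    using D_law(1) inj_f by (intro distr_PiM_reindex[symmetric]) auto
  also have "\<dots> = distr (PiM I (\<lambda>_. D)) (PiM J (\<lambda>_. N)) (\<lambda>x. \<lambda>j\<in>J. x (f j))"
    by (intro distr_cong refl sets_PiM_cong D_law(2))
  also have "\<dots> = distr M (PiM J (\<lambda>_. N)) (\<lambda>\<omega>. \<lambda>j\<in>J. X (f j) \<omega>)"
    unfolding joint[symmetric] distr_distr[OF reindex meas_X]
    using inj_f(2) by (intro distr_cong refl) (auto simp: fun_eq_iff)
  finally show ?thesis ..
qed

lemma (in prob_space) exchangeable_if_indep_vars:
  assumes indep: "indep_vars (\<lambda>_. N) X I" and law: "\<And>i. i \<in> I \<Longrightarrow> distr M N (X i) = D"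
  shows "exchangeable M I N X"
proof (cases "I = {}")
  case False
  then show ?thesis
    using indep distr_indep_vars_reindex[OF indep law, of _ I]
      distr_indep_vars_reindex[OF indep law, of id I]
    by (auto simp: exchangeable_def indep_vars_def permutes_inj_on permutes_image)
qed (simp add: exchangeable_def restrict_def)

locale stationary_increments = prob_space M for M :: "'a measure" +
  fixes Z :: "real \<Rightarrow> 'a \<Rightarrow> 'h::{real_inner,complete_space,second_countable_topology}"
  assumes measurable_process: "\<And>u. 0 \<le> u \<Longrightarrow> Z u \<in> borel_measurable M"
    and indep_increments: "\<And>(n::nat) r. 0 \<le> r 0 \<Longrightarrow> (\<And>k. k < n \<Longrightarrow> r k \<le> r (Suc k)) \<Longrightarrow>
          indep_vars (\<lambda>_. borel) (\<lambda>k \<omega>. Z (r (Suc k)) \<omega> - Z (r k) \<omega>) {..<n}"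
    and stationary: "\<And>s h. 0 \<le> s \<Longrightarrow> 0 \<le> h \<Longrightarrow>
          distr M borel (\<lambda>\<omega>. Z (s + h) \<omega> - Z s \<omega>) = distr M borel (\<lambda>\<omega>. Z h \<omega> - Z 0 \<omega>)"
    and stochastically_continuous: "\<And>u v. (\<And>k. 0 \<le> u k) \<Longrightarrow> 0 \<le> v \<Longrightarrow> u \<longlonglongrightarrow> v \<Longrightarrow>
          conv_in_prob M (\<lambda>k. Z (u k)) (Z v)"
begin

definition increment :: "real \<Rightarrow> nat \<Rightarrow> 'a \<Rightarrow> 'h" where
  "increment h k \<omega> = Z (real (Suc k) * h) \<omega> - Z (real k * h) \<omega>"

lemma measurable_increment: "0 \<le> h \<Longrightarrow> increment h k \<in> borel_measurable M"
  unfolding increment_def[abs_def] by (intro borel_measurable_diff measurable_process) auto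

lemma indep_vars_increment: "0 \<le> h \<Longrightarrow> indep_vars (\<lambda>_. borel) (increment h) {..<n}"
  using indep_increments[of "\<lambda>k. real k * h" n]
  by (simp add: increment_def[abs_def] mult_right_mono)

lemma distr_increment:
  "0 \<le> h \<Longrightarrow> distr M borel (increment h k) = distr M borel (\<lambda>\<omega>. Z h \<omega> - Z 0 \<omega>)"
  using stationary[of "real k * h" h]
  by (simp add: increment_def[abs_def] distrib_right add.commute)

lemma exchangeable_increment: "0 \<le> h \<Longrightarrow> exchangeable M {..<n} borel (increment h)"
  by (rule exchangeable_if_indep_vars[OF indep_vars_increment distr_increment])

lemma sum_increment:
  assumes "m \<le> n"
  shows "(\<Sum>k\<in>{m..<n}. increment h k \<omega>) = Z (real n * h) \<omega> - Z (real m * h) \<omega>"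
  using sum_Suc_diff'[OF assms, of "\<lambda>k. Z (real k * h) \<omega>"] by (simp add: increment_def)

lemma close_in_prob_sum_increments:
  fixes V :: "'h \<Rightarrow>\<^sub>L 'k::{real_normed_vector,second_countable_topology}"
  assumes h_nonneg: "0 \<le> h" and A_subset: "A \<subseteq> {..<n}"
    and small: "\<And>s. s \<in> {0..real n * h} \<Longrightarrow> close_in_prob M (\<eta> / 2) (\<lambda>\<omega>. V (Z s \<omega>)) (\<lambda>_. 0)"
  shows "close_in_prob M \<eta> (\<lambda>\<omega>. \<Sum>k\<in>A. V (increment h k \<omega>)) (\<lambda>_. 0)"
proof -
  have [measurable]: "(\<lambda>\<omega>. V (increment h k \<omega>)) \<in> borel_measurable M"
    "0 \<le> s \<Longrightarrow> (\<lambda>\<omega>. V (Z s \<omega>)) \<in> borel_measurable M" for k s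
    by (auto intro!: borel_measurable_blinfun_apply_const measurable_increment measurable_process h_nonneg)
  have card: "card A \<le> n" using card_mono[OF _ A_subset] by simp
  then have end_point: "real (card A) * h \<in> {0..real n * h}" using h_nonneg by (simp add: mult_right_mono)
  have "exchangeable M {..<n} borel (\<lambda>k \<omega>. V (increment h k \<omega>))"
    by (rule exchangeable_compose[OF exchangeable_increment[OF h_nonneg] finite_lessThan])
      (rule borel_measurable_blinfun_apply_const, simp)
  from exchangeable_distr_sum[OF this finite_lessThan A_subset, of "{..<card A}"] card
  have "close_in_prob M \<eta> (\<lambda>\<omega>. \<Sum>k\<in>A. V (increment h k \<omega>)) (\<lambda>_. 0) \<longleftrightarrow>
      close_in_prob M \<eta> (\<lambda>\<omega>. \<Sum>k<card A. V (increment h k \<omega>)) (\<lambda>_. 0)"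
    by (simp add: close_in_prob_0_iff_distr)
  moreover have "(\<Sum>k<card A. V (increment h k \<omega>)) = V (Z (real (card A) * h) \<omega>) - V (Z 0 \<omega>)" for \<omega>
    using sum_increment[of 0 "card A" h \<omega>]
    by (simp add: atLeast0LessThan flip: blinfun.sum_right blinfun.diff_right)
  moreover have "close_in_prob M (\<eta> / 2 + \<eta> / 2)
      (\<lambda>\<omega>. V (Z (real (card A) * h) \<omega>) - V (Z 0 \<omega>)) (\<lambda>_. 0)"
    using h_nonneg by (intro close_in_prob_combine[OF _ _ _ _ small[OF end_point] small[of 0]])
      (auto intro: norm_triangle_ineq4)
  ultimately show ?thesis by simp
qed

lemma ex_uniformly_close_to_0:
  fixes V :: "nat \<Rightarrow> 'h \<Rightarrow>\<^sub>L 'k::{real_normed_vector,second_countable_topology}"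
  assumes bound: "\<And>n x. norm (V n x) \<le> norm x" and lim: "\<And>x. (\<lambda>n. V n x) \<longlonglongrightarrow> 0" and "0 < \<eta>"
  shows "\<exists>n. \<forall>s\<in>{0..T}. close_in_prob M \<eta> (\<lambda>\<omega>. V n (Z s \<omega>)) (\<lambda>_. 0)"
proof (rule ccontr)
  assume "\<not> ?thesis"
  then obtain s where s_not_close: "\<And>n. s n \<in> {0..T}" "\<And>n. \<not> close_in_prob M \<eta> (\<lambda>\<omega>. V n (Z (s n) \<omega>)) (\<lambda>_. 0)"
    by metis
  obtain l r where l_in: "l \<in> {0..T}" and strict_mono_r: "strict_mono r" and conv: "(s \<circ> r) \<longlonglongrightarrow> l"
    using compact_Icc[of 0 T] s_not_close(1) unfolding compact_def by metis
  have meas_Z [measurable]: "Z (s n) \<in> borel_measurable M" "Z l \<in> borel_measurable M" for n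
    using s_not_close(1)[of n] l_in by (auto intro!: measurable_process)
  have meas_VZ [measurable]: "(\<lambda>\<omega>. V n (Z (s m) \<omega>)) \<in> borel_measurable M"
    "(\<lambda>\<omega>. V n (Z l \<omega>)) \<in> borel_measurable M" for n m
    by (auto intro: borel_measurable_blinfun_apply_const meas_Z)
  have "conv_in_prob M (\<lambda>k. Z (s (r k))) (Z l)"
    using s_not_close(1) l_in conv by (intro stochastically_continuous) (auto simp: comp_def)
  then have close_Z: "eventually (\<lambda>k. close_in_prob M (\<eta> / 2) (Z (s (r k))) (Z l)) sequentially"
    using \<open>0 < \<eta>\<close> by (simp add: conv_in_prob_iff_eventually_close)
  have "conv_in_prob M (\<lambda>k \<omega>. V (r k) (Z l \<omega>)) (\<lambda>_. 0)"
    using LIMSEQ_subseq_LIMSEQ[OF lim strict_mono_r]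
    by (intro AE_tendsto_imp_conv_in_prob) (auto simp: comp_def)
  then have close_V: "eventually (\<lambda>k. close_in_prob M (\<eta> / 2) (\<lambda>\<omega>. V (r k) (Z l \<omega>)) (\<lambda>_. 0)) sequentially"
    using \<open>0 < \<eta>\<close> by (simp add: conv_in_prob_iff_eventually_close)
  have contraction: "dist (V n x) (V n y) \<le> 1 * dist x y" for n x y
    using bound[of n "x - y"] by (simp add: dist_norm blinfun.diff_right)
  have "eventually (\<lambda>k. close_in_prob M \<eta> (\<lambda>\<omega>. V (r k) (Z (s (r k)) \<omega>)) (\<lambda>_. 0)) sequentially"
    using close_Z close_V
  proof eventually_elim
    case (elim k)
    have "close_in_prob M (\<eta> / 2) (\<lambda>\<omega>. V (r k) (Z (s (r k)) \<omega>)) (\<lambda>\<omega>. V (r k) (Z l \<omega>))"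
      by (rule close_in_prob_lipschitz[OF meas_Z elim(1) contraction]) auto
    then show ?case using elim(2) by (rule close_in_prob_half_triangle[OF meas_VZ, rotated]) simp
  qed
  then show False using s_not_close(2) by (auto dest: eventually_happens)
qed

definition increment_sum :: "real \<Rightarrow> nat \<Rightarrow> (nat \<Rightarrow> 'h \<Rightarrow>\<^sub>L 'h) \<Rightarrow> 'a \<Rightarrow> 'h" where
  "increment_sum h n \<Phi> \<omega> = (\<Sum>k<n. \<Phi> k (increment h k \<omega>))"

lemma measurable_increment_sum: "0 \<le> h \<Longrightarrow> increment_sum h n \<Phi> \<in> borel_measurable M"
  unfolding increment_sum_def[abs_def]
  by (intro borel_measurable_sum borel_measurable_blinfun_apply_const measurable_increment)

lemma increment_sum_add:
  "increment_sum h n \<Phi> \<omega> + increment_sum h n \<Psi> \<omega> = increment_sum h n (\<lambda>k. \<Phi> k + \<Psi> k) \<omega>"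
  by (simp add: increment_sum_def blinfun.add_left sum.distrib)

lemma measurable_step_integral:
  assumes "\<And>i. i \<le> N \<Longrightarrow> 0 \<le> p i"
  shows "step_integral Z \<Phi> p N \<in> borel_measurable M"
  using assms unfolding step_integral_def[abs_def]
  by (intro borel_measurable_sum borel_measurable_blinfun_apply_const borel_measurable_diff
      measurable_process) auto

lemma conv_in_prob_step_integral:
  assumes p_nonneg: "\<And>i L. i \<le> N \<Longrightarrow> 0 \<le> p L i" "\<And>i. i \<le> N \<Longrightarrow> 0 \<le> p' i"
    and lim: "\<And>i. i \<le> N \<Longrightarrow> (\<lambda>L. p L i) \<longlonglongrightarrow> p' i"
  shows "conv_in_prob M (\<lambda>L. step_integral Z \<Phi> (p L) N) (step_integral Z \<Phi> p' N)"
proof -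
  have meas: "Z (p L i) \<in> borel_measurable M" "Z (p' i) \<in> borel_measurable M" if "i \<le> N" for i L
    using p_nonneg that by (auto intro!: measurable_process)
  have conv: "conv_in_prob M (\<lambda>L. Z (p L i)) (Z (p' i))" if "i \<le> N" for i
    using p_nonneg lim that by (intro stochastically_continuous) auto
  have lipschitz: "dist (B x) (B y) \<le> norm B * dist x y" for B :: "'h \<Rightarrow>\<^sub>L 'h" and x y
    using norm_blinfun[of B "x - y"] by (simp add: dist_norm blinfun.diff_right)
  have "conv_in_prob M (\<lambda>L \<omega>. \<Sum>i<N. \<Phi> i (Z (p L (Suc i)) \<omega>) + (- \<Phi> i) (Z (p L i) \<omega>))
      (\<lambda>\<omega>. \<Sum>i<N. \<Phi> i (Z (p' (Suc i)) \<omega>) + (- \<Phi> i) (Z (p' i) \<omega>))"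
    by (intro conv_in_prob_sum conv_in_prob_add finite_lessThan borel_measurable_add
        borel_measurable_blinfun_apply_const meas conv_in_prob_lipschitz[OF _ _ conv lipschitz]) auto
  then show ?thesis
    unfolding step_integral_def[abs_def] by (simp add: blinfun.diff_right blinfun.minus_left)
qed

end

section \<open>Riemann sums\<close>

locale stochastic_integral = stationary_increments M Z
  for M :: "'a measure" and Z :: "real \<Rightarrow> 'a \<Rightarrow> 'h::{real_inner,complete_space,second_countable_topology}" +
  fixes G :: "real \<Rightarrow> 'h \<Rightarrow>\<^sub>L 'h" and t C :: real
  assumes t_pos: "0 < t"
    and G_bound: "\<And>u. u \<in> {0..t} \<Longrightarrow> norm (G u) \<le> C"
    and G_continuous: "\<And>x. continuous_on {0..t} (\<lambda>u. G u x)"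
begin

definition mesh_size :: "nat \<Rightarrow> real" where
  "mesh_size L = t / real L"

abbreviation grid_sum :: "nat \<Rightarrow> (nat \<Rightarrow> 'h \<Rightarrow>\<^sub>L 'h) \<Rightarrow> 'a \<Rightarrow> 'h" where
  "grid_sum L \<equiv> increment_sum (mesh_size L) L"

lemma mesh_size_nonneg: "0 \<le> mesh_size L"
  using t_pos by (simp add: mesh_size_def)

lemma mesh_size_tendsto_0: "mesh_size \<longlonglongrightarrow> 0"
  unfolding mesh_size_def[abs_def] by (rule lim_const_over_n)

lemma grid_point_le: "l \<le> L \<Longrightarrow> real l * mesh_size L \<le> t"
  using t_pos by (cases "L = 0") (auto simp: mesh_size_def field_simps)

lemma measurable_grid_sum [measurable]: "grid_sum L \<Phi> \<in> borel_measurable M"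
  by (rule measurable_increment_sum[OF mesh_size_nonneg])

lemma ex_close_in_prob_grid_sum_compose:
  assumes "0 < \<epsilon>" "0 \<le> K"
  shows "\<exists>\<eta>>0. \<forall>(V :: 'h \<Rightarrow>\<^sub>L 'h) L \<Phi>. (\<forall>s\<in>{0..t}. close_in_prob M \<eta> (\<lambda>\<omega>. blinfun_apply V (Z s \<omega>)) (\<lambda>_. 0)) \<longrightarrow>
    (\<forall>l<L. norm (\<Phi> l) \<le> K) \<longrightarrow> close_in_prob M \<epsilon> (grid_sum L (\<lambda>l. \<Phi> l o\<^sub>L V)) (\<lambda>_. 0)"
proof -
  obtain \<eta> where "0 < \<eta>" and small: "\<And>(I :: nat set) (\<xi> :: nat \<Rightarrow> 'a \<Rightarrow> 'h) (\<Phi> :: nat \<Rightarrow> 'h \<Rightarrow>\<^sub>L 'h).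
       finite I \<Longrightarrow> exchangeable M I borel \<xi> \<Longrightarrow>
       (\<And>A. A \<subseteq> I \<Longrightarrow> close_in_prob M \<eta> (\<lambda>\<omega>. \<Sum>i\<in>A. \<xi> i \<omega>) (\<lambda>_. 0)) \<Longrightarrow>
       (\<And>i. i \<in> I \<Longrightarrow> norm (\<Phi> i) \<le> K) \<Longrightarrow>
       close_in_prob M \<epsilon> (\<lambda>\<omega>. \<Sum>i\<in>I. blinfun_apply (\<Phi> i) (\<xi> i \<omega>)) (\<lambda>_. 0)"
    using ex_close_in_prob_exchangeable_operator_sum[OF assms] by blast
  show ?thesis
  proof (intro exI[of _ "\<eta> / 2"] conjI allI impI)
    fix V :: "'h \<Rightarrow>\<^sub>L 'h" and L and \<Phi> :: "nat \<Rightarrow> 'h \<Rightarrow>\<^sub>L 'h"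
    assume V: "\<forall>s\<in>{0..t}. close_in_prob M (\<eta> / 2) (\<lambda>\<omega>. V (Z s \<omega>)) (\<lambda>_. 0)" and \<Phi>: "\<forall>l<L. norm (\<Phi> l) \<le> K"
    have "close_in_prob M \<epsilon> (\<lambda>\<omega>. \<Sum>l<L. \<Phi> l (V (increment (mesh_size L) l \<omega>))) (\<lambda>_. 0)"
    proof (rule small)
      show "exchangeable M {..<L} borel (\<lambda>l \<omega>. V (increment (mesh_size L) l \<omega>))"
        by (rule exchangeable_compose[OF exchangeable_increment[OF mesh_size_nonneg] finite_lessThan])
          (rule borel_measurable_blinfun_apply_const, simp)
      show "close_in_prob M \<eta> (\<lambda>\<omega>. \<Sum>l\<in>A. V (increment (mesh_size L) l \<omega>)) (\<lambda>_. 0)" if "A \<subseteq> {..<L}" for A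
        using V grid_point_le[of L L] by (intro close_in_prob_sum_increments[OF mesh_size_nonneg that]) auto
    qed (use \<Phi> in auto)
    then show "close_in_prob M \<epsilon> (grid_sum L (\<lambda>l. \<Phi> l o\<^sub>L V)) (\<lambda>_. 0)"
      by (simp add: increment_sum_def[abs_def])
  qed (use \<open>0 < \<eta>\<close> in simp)
qed

lemma ex_close_in_prob_grid_sum_small:
  assumes "0 < \<epsilon>"
  shows "\<exists>\<rho>>0. \<forall>L \<Phi>. (\<forall>l<L. norm (\<Phi> l) \<le> \<rho>) \<longrightarrow> close_in_prob M \<epsilon> (grid_sum L \<Phi>) (\<lambda>_. 0)"
proof -
  obtain \<eta> where "0 < \<eta>" and small: "\<And>(V :: 'h \<Rightarrow>\<^sub>L 'h) L \<Phi>.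
      \<forall>s\<in>{0..t}. close_in_prob M \<eta> (\<lambda>\<omega>. blinfun_apply V (Z s \<omega>)) (\<lambda>_. 0) \<Longrightarrow>
      \<forall>l<L. norm (\<Phi> l) \<le> 1 \<Longrightarrow> close_in_prob M \<epsilon> (grid_sum L (\<lambda>l. \<Phi> l o\<^sub>L V)) (\<lambda>_. 0)"
    using ex_close_in_prob_grid_sum_compose[OF assms zero_le_one] by blast
  define c where "c m = inverse (real (Suc m))" for m
  define V where "V m = c m *\<^sub>R (id_blinfun :: 'h \<Rightarrow>\<^sub>L 'h)" for m
  have "norm (V m x) \<le> norm x" for m x
    by (simp add: V_def c_def blinfun.scaleR_left mult_left_le_one_le inverse_le_1_iff)
  moreover have "(\<lambda>m. V m x) \<longlonglongrightarrow> 0" for x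
    using tendsto_scaleR[OF LIMSEQ_inverse_real_of_nat tendsto_const, of x]
    by (simp add: V_def c_def blinfun.scaleR_left)
  ultimately obtain m where V_m_small: "\<forall>s\<in>{0..t}. close_in_prob M \<eta> (\<lambda>\<omega>. V m (Z s \<omega>)) (\<lambda>_. 0)"
    using ex_uniformly_close_to_0[of V \<eta> t] \<open>0 < \<eta>\<close> by blast
  have "0 < c m" by (simp add: c_def)
  have "close_in_prob M \<epsilon> (grid_sum L \<Phi>) (\<lambda>_. 0)" if "\<forall>l<L. norm (\<Phi> l) \<le> c m" for L \<Phi>
  proof -
    have "\<forall>l<L. norm ((1 / c m) *\<^sub>R \<Phi> l) \<le> 1" using that \<open>0 < c m\<close> by (simp add: field_simps)
    moreover have "((1 / c m) *\<^sub>R \<Phi> l) o\<^sub>L V m = \<Phi> l" for l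
      using \<open>0 < c m\<close> by (intro blinfun_eqI) (simp add: V_def blinfun.scaleR_left blinfun.scaleR_right)
    ultimately show ?thesis using small[OF V_m_small, of L "\<lambda>l. (1 / c m) *\<^sub>R \<Phi> l"] by simp
  qed
  then show ?thesis using \<open>0 < c m\<close> by blast
qed

lemma ex_close_in_prob_grid_sum_deflation:
  assumes "0 < \<epsilon>" "0 \<le> K" "closure (range d) = UNIV"
  shows "\<exists>n. \<forall>L \<Phi>. (\<forall>l<L. norm (\<Phi> l) \<le> K) \<longrightarrow>
    close_in_prob M \<epsilon> (grid_sum L (\<lambda>l. \<Phi> l o\<^sub>L deflation d n)) (\<lambda>_. 0)"
proof -
  obtain \<eta> where "0 < \<eta>" and small: "\<And>(V :: 'h \<Rightarrow>\<^sub>L 'h) L \<Phi>.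
      \<forall>s\<in>{0..t}. close_in_prob M \<eta> (\<lambda>\<omega>. blinfun_apply V (Z s \<omega>)) (\<lambda>_. 0) \<Longrightarrow>
      \<forall>l<L. norm (\<Phi> l) \<le> K \<Longrightarrow> close_in_prob M \<epsilon> (grid_sum L (\<lambda>l. \<Phi> l o\<^sub>L V)) (\<lambda>_. 0)"
    using ex_close_in_prob_grid_sum_compose[OF assms(1,2)] by blast
  obtain n where "\<forall>s\<in>{0..t}. close_in_prob M \<eta> (\<lambda>\<omega>. deflation d n (Z s \<omega>)) (\<lambda>_. 0)"
    using ex_uniformly_close_to_0[OF norm_deflation_le deflation_tendsto_0[OF assms(3)] \<open>0 < \<eta>\<close>] by blast
  from small[OF this] show ?thesis by blast
qed

lemma ex_close_in_prob_grid_sum_diff: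
  assumes "0 < \<epsilon>"
  shows "\<exists>\<delta>>0. \<forall>L a b. (\<forall>l<L. a l \<in> {0..t} \<and> b l \<in> {0..t} \<and> \<bar>a l - b l\<bar> < \<delta>) \<longrightarrow>
    close_in_prob M \<epsilon> (grid_sum L (\<lambda>l. G (a l) - G (b l))) (\<lambda>_. 0)"
proof -
  have C_nonneg: "0 \<le> 2 * C" using G_bound[of 0] t_pos order_trans[OF norm_ge_zero] by simp
  have "0 < \<epsilon> / 2" using assms by simp
  obtain d :: "nat \<Rightarrow> 'h" where dense: "closure (range d) = UNIV"
    using ex_dense_sequence .
  obtain n where deflated_close: "\<And>L \<Phi>. \<forall>l<L. norm (\<Phi> l) \<le> 2 * C \<Longrightarrow>
      close_in_prob M (\<epsilon> / 2) (grid_sum L (\<lambda>l. \<Phi> l o\<^sub>L deflation d n)) (\<lambda>_. 0)"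
    using ex_close_in_prob_grid_sum_deflation[OF \<open>0 < \<epsilon> / 2\<close> C_nonneg dense] by blast
  obtain \<rho> where "0 < \<rho>" and \<rho>: "\<And>L \<Phi>. \<forall>l<L. norm (\<Phi> l) \<le> \<rho> \<Longrightarrow>
      close_in_prob M (\<epsilon> / 2) (grid_sum L \<Phi>) (\<lambda>_. 0)"
    using ex_close_in_prob_grid_sum_small[OF \<open>0 < \<epsilon> / 2\<close>] by blast
  define P where "P = id_blinfun - deflation d n"
  have "uniformly_continuous_on {0..t} (\<lambda>u. G u o\<^sub>L P)"
    unfolding P_def
    by (intro compact_uniformly_continuous continuous_on_blinfun_compose_id_minus_deflation
        G_continuous compact_Icc)
  then obtain \<delta> where "0 < \<delta>" and \<delta>: "\<And>a b. a \<in> {0..t} \<Longrightarrow> b \<in> {0..t} \<Longrightarrow> \<bar>a - b\<bar> < \<delta> \<Longrightarrow>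
      norm ((G a o\<^sub>L P) - (G b o\<^sub>L P)) < \<rho>"
    unfolding uniformly_continuous_on_def dist_norm real_norm_def using \<open>0 < \<rho>\<close> by metis
  have "close_in_prob M \<epsilon> (grid_sum L (\<lambda>l. G (a l) - G (b l))) (\<lambda>_. 0)"
    if ab: "\<forall>l<L. a l \<in> {0..t} \<and> b l \<in> {0..t} \<and> \<bar>a l - b l\<bar> < \<delta>" for L a b
  proof -
    let ?D = "\<lambda>l. (G (a l) - G (b l)) o\<^sub>L deflation d n" and ?P = "\<lambda>l. (G (a l) o\<^sub>L P) - (G (b l) o\<^sub>L P)"
    have "norm (G (a l) - G (b l)) \<le> 2 * C" if "l < L" for l
      using norm_triangle_ineq4[of "G (a l)" "G (b l)"] G_bound[of "a l"] G_bound[of "b l"] ab that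
      by fastforce
    then have "close_in_prob M (\<epsilon> / 2) (grid_sum L ?D) (\<lambda>_. 0)" by (intro deflated_close) auto
    moreover have "close_in_prob M (\<epsilon> / 2) (grid_sum L ?P) (\<lambda>_. 0)"
      using ab \<delta> by (intro \<rho>) (auto intro: less_imp_le)
    ultimately have "close_in_prob M (\<epsilon> / 2 + \<epsilon> / 2) (\<lambda>\<omega>. grid_sum L ?D \<omega> + grid_sum L ?P \<omega>) (\<lambda>_. 0 + 0)"
      by (intro close_in_prob_add) auto
    moreover have "?D l + ?P l = G (a l) - G (b l)" for l
      by (rule blinfun_eqI) (simp add: P_def blinfun.diff_left blinfun.add_left blinfun.diff_right)
    ultimately show ?thesis by (simp add: increment_sum_add)
  qed
  then show ?thesis using \<open>0 < \<delta>\<close> by blast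
qed

end

definition block_index :: "(nat \<Rightarrow> nat) \<Rightarrow> nat \<Rightarrow> nat" where
  "block_index q l = (LEAST i. l < q (Suc i))"

lemma block_index_eq:
  assumes "\<And>i j. i \<le> j \<Longrightarrow> j \<le> N \<Longrightarrow> q i \<le> q j" "i < N" "l \<in> {q i..<q (Suc i)}"
  shows "block_index q l = i"
  unfolding block_index_def
proof (rule Least_equality)
  show "l < q (Suc i)" using assms(3) by simp
  show "i \<le> j" if "l < q (Suc j)" for j
  proof (rule ccontr)
    assume "\<not> i \<le> j"
    then have "q (Suc j) \<le> q i" using assms(1)[of "Suc j" i] assms(2) by simp
    then show False using that assms(3) by simp
  qed
qed

lemma block_index_bounds:
  assumes "q 0 = 0" "l < q N"
  shows "block_index q l < N" "q (block_index q l) \<le> l" "l < q (Suc (block_index q l))"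
proof -
  obtain m where N_eq: "N = Suc m" using assms by (cases N) auto
  then have "block_index q l \<le> m" unfolding block_index_def using assms(2) by (intro Least_le) simp
  then show "block_index q l < N" using N_eq by simp
  show "l < q (Suc (block_index q l))"
    unfolding block_index_def by (rule LeastI[of _ m]) (use assms(2) N_eq in simp)
  show "q (block_index q l) \<le> l"
  proof (cases "block_index q l")
    case (Suc j)
    then have "\<not> l < q (Suc j)" unfolding block_index_def by (intro not_less_Least) simp
    then show ?thesis using Suc by simp
  qed (simp add: assms(1))
qed

lemma sum_consecutive_intervals:
  fixes q :: "nat \<Rightarrow> nat" and f :: "nat \<Rightarrow> 'b::comm_monoid_add"
  assumes "\<And>i. i < N \<Longrightarrow> q i \<le> q (Suc i)"
  shows "(\<Sum>i<N. \<Sum>l\<in>{q i..<q (Suc i)}. f l) = (\<Sum>l\<in>{q 0..<q N}. f l)"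
  using assms
proof (induction N)
  case (Suc N)
  have "q 0 \<le> q N" using Suc.prems by (induction N) (auto intro: order_trans)
  then show ?case using Suc by (simp add: sum.atLeastLessThan_concat)
qed simp

lemma (in stationary_increments) step_integral_grid_eq_increment_sum:
  assumes mono: "\<And>i j. i \<le> j \<Longrightarrow> j \<le> N \<Longrightarrow> q i \<le> q j" and "q 0 = 0"
  shows "step_integral Z \<Phi> (\<lambda>i. real (q i) * h) N = increment_sum h (q N) (\<lambda>l. \<Phi> (block_index q l))"
proof
  fix \<omega>
  have "step_integral Z \<Phi> (\<lambda>i. real (q i) * h) N \<omega>
      = (\<Sum>i<N. \<Sum>l\<in>{q i..<q (Suc i)}. \<Phi> i (increment h l \<omega>))"
    unfolding step_integral_def
    by (intro sum.cong refl) (simp add: mono flip: sum_increment blinfun.sum_right)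
  also have "\<dots> = (\<Sum>i<N. \<Sum>l\<in>{q i..<q (Suc i)}. \<Phi> (block_index q l) (increment h l \<omega>))"
    by (intro sum.cong refl) (simp add: block_index_eq[of N q, OF mono])
  also have "\<dots> = increment_sum h (q N) (\<lambda>l. \<Phi> (block_index q l)) \<omega>"
    by (subst sum_consecutive_intervals) (simp_all add: mono \<open>q 0 = 0\<close> increment_sum_def atLeast0LessThan)
  finally show "step_integral Z \<Phi> (\<lambda>i. real (q i) * h) N \<omega>
      = increment_sum h (q N) (\<lambda>l. \<Phi> (block_index q l)) \<omega>" .
qed

definition fine_tagged_partition ::
  "real \<Rightarrow> real \<Rightarrow> nat \<Rightarrow> (nat \<Rightarrow> real) \<Rightarrow> (nat \<Rightarrow> real) \<Rightarrow> bool" where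
  "fine_tagged_partition T \<delta> N p \<sigma> \<longleftrightarrow>
     is_partition T N p \<and> (\<forall>i<N. p i \<le> \<sigma> i \<and> \<sigma> i \<le> p (Suc i) \<and> p (Suc i) - p i \<le> \<delta>)"

lemma fine_tagged_partition_mono:
  "fine_tagged_partition T \<delta> N p \<sigma> \<Longrightarrow> \<delta> \<le> \<delta>' \<Longrightarrow> fine_tagged_partition T \<delta>' N p \<sigma>"
  by (force simp: fine_tagged_partition_def)

lemma fine_tagged_partition_equidistant:
  assumes "0 < T" "0 < L"
  shows "fine_tagged_partition T (T / real L) L (\<lambda>k. real k * (T / real L)) (\<lambda>k. real k * (T / real L))"
  using assms by (auto simp: fine_tagged_partition_def is_partition_def field_simps)

lemma fine_tagged_partition_reverse:
  assumes "is_partition T N p" "\<And>i. i < N \<Longrightarrow> p i \<le> \<sigma> i \<and> \<sigma> i \<le> p (Suc i)"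
  shows "fine_tagged_partition T (mesh N p) N (\<lambda>k. T - p (N - k)) (\<lambda>k. T - \<sigma> (N - Suc k))"
proof -
  have "p (Suc i) - p i \<le> mesh N p" if "i < N" for i
    unfolding mesh_def using that by (intro Max_ge) auto
  then have "p (N - k) - p (N - Suc k) \<le> mesh N p \<and> p (N - Suc k) < p (N - k) \<and>
      p (N - Suc k) \<le> \<sigma> (N - Suc k) \<and> \<sigma> (N - Suc k) \<le> p (N - k)" if "k < N" for k
    using assms that by (simp add: is_partition_def Suc_diff_Suc[symmetric])
  then show ?thesis using assms(1) by (simp add: fine_tagged_partition_def is_partition_def)
qed

lemma is_partition_mono:
  assumes "is_partition T N p" "i \<le> j" "j \<le> N"
  shows "p i \<le> p j"
  using assms(2,3)
proof (induction j rule: dec_induct)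
  case (step j)
  then have "p j < p (Suc j)" using assms(1) by (simp add: is_partition_def)
  then show ?case using step by simp
qed simp

lemma is_partition_bounds:
  assumes "is_partition T N p" "i \<le> N"
  shows "0 \<le> p i" "p i \<le> T"
  using is_partition_mono[OF assms(1), of 0 i] is_partition_mono[OF assms(1), of i N] assms
  by (auto simp: is_partition_def)

context stochastic_integral
begin

definition grid_index :: "nat \<Rightarrow> real \<Rightarrow> nat" where
  "grid_index L u = nat \<lfloor>u / mesh_size L\<rfloor>"

lemma grid_index_bounds:
  assumes "0 \<le> u" "0 < L"
  shows "real (grid_index L u) * mesh_size L \<le> u"
    and "u < real (Suc (grid_index L u)) * mesh_size L"
proof -
  have mesh_pos: "0 < mesh_size L" using assms t_pos by (simp add: mesh_size_def)
  then have index: "real (grid_index L u) = of_int \<lfloor>u / mesh_size L\<rfloor>"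
    using assms by (simp add: grid_index_def)
  have "real (grid_index L u) \<le> u / mesh_size L" "u / mesh_size L < real (Suc (grid_index L u))"
    unfolding of_nat_Suc index by linarith+
  then show "real (grid_index L u) * mesh_size L \<le> u" "u < real (Suc (grid_index L u)) * mesh_size L"
    using mesh_pos by (simp_all only: pos_le_divide_eq pos_divide_less_eq)
qed

lemma grid_index_tendsto:
  assumes "0 \<le> u"
  shows "(\<lambda>L. real (grid_index L u) * mesh_size L) \<longlonglongrightarrow> u"
proof (rule tendsto_sandwich)
  have "u - mesh_size L \<le> real (grid_index L u) * mesh_size L" if "0 < L" for L
    using grid_index_bounds(2)[OF assms that] by (simp add: distrib_right)
  then show "eventually (\<lambda>L. u - mesh_size L \<le> real (grid_index L u) * mesh_size L) sequentially"
    using eventually_gt_at_top[of 0] by (rule eventually_mono[rotated])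
  show "eventually (\<lambda>L. real (grid_index L u) * mesh_size L \<le> u) sequentially"
    using eventually_gt_at_top[of 0] by eventually_elim (rule grid_index_bounds[OF assms])
  show "(\<lambda>L. u - mesh_size L) \<longlonglongrightarrow> u"
    using tendsto_diff[OF tendsto_const mesh_size_tendsto_0, of u] by simp
qed simp

lemma tag_near_grid_point:
  assumes part: "fine_tagged_partition t \<delta> N p \<sigma>" and "0 < L" "l < L"
  defines "i \<equiv> block_index (\<lambda>i. grid_index L (p i)) l"
  shows "\<sigma> i \<in> {0..t}" "\<bar>\<sigma> i - real l * mesh_size L\<bar> \<le> \<delta> + mesh_size L"
proof -
  have is_part: "is_partition t N p" using part by (simp add: fine_tagged_partition_def)
  have "grid_index L (p 0) = 0" "grid_index L (p N) = L"
    using is_part t_pos \<open>0 < L\<close> by (simp_all add: grid_index_def mesh_size_def is_partition_def)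
  then have i_bounds: "i < N" "grid_index L (p i) \<le> l" "l < grid_index L (p (Suc i))"
    using block_index_bounds[of "\<lambda>i. grid_index L (p i)" l N] \<open>l < L\<close> by (simp_all add: i_def)
  note p_i = is_partition_bounds[OF is_part less_imp_le[OF i_bounds(1)]]
    and p_Suc_i = is_partition_bounds[OF is_part Suc_leI[OF i_bounds(1)]]
  have tag: "p i \<le> \<sigma> i" "\<sigma> i \<le> p (Suc i)" "p (Suc i) - p i \<le> \<delta>"
    using part i_bounds(1) by (auto simp: fine_tagged_partition_def)
  show "\<sigma> i \<in> {0..t}" using tag p_i p_Suc_i by auto
  have "p i < real (Suc (grid_index L (p i))) * mesh_size L"
    by (rule grid_index_bounds[OF p_i(1) \<open>0 < L\<close>])
  also have "\<dots> \<le> real (Suc l) * mesh_size L"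
    using i_bounds(2) mesh_size_nonneg by (intro mult_right_mono) auto
  finally have lower: "p i < real l * mesh_size L + mesh_size L" by (simp add: distrib_right)
  have "real l * mesh_size L \<le> real (grid_index L (p (Suc i))) * mesh_size L"
    using i_bounds(3) mesh_size_nonneg by (intro mult_right_mono) auto
  also have "\<dots> \<le> p (Suc i)" by (rule grid_index_bounds[OF p_Suc_i(1) \<open>0 < L\<close>])
  finally show "\<bar>\<sigma> i - real l * mesh_size L\<bar> \<le> \<delta> + mesh_size L"
    using lower tag mesh_size_nonneg[of L] by linarith
qed

definition riemann_sum :: "nat \<Rightarrow> (nat \<Rightarrow> real) \<Rightarrow> (nat \<Rightarrow> real) \<Rightarrow> 'a \<Rightarrow> 'h" where
  "riemann_sum N p \<sigma> = step_integral Z (\<lambda>k. G (\<sigma> k)) p N"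

definition grid_riemann_sum :: "nat \<Rightarrow> 'a \<Rightarrow> 'h" where
  "grid_riemann_sum L = grid_sum L (\<lambda>l. G (real l * mesh_size L))"

lemma measurable_riemann_sum: "is_partition t N p \<Longrightarrow> riemann_sum N p \<sigma> \<in> borel_measurable M"
  unfolding riemann_sum_def by (rule measurable_step_integral) (rule is_partition_bounds)

lemma measurable_grid_riemann_sum [measurable]: "grid_riemann_sum L \<in> borel_measurable M"
  unfolding grid_riemann_sum_def by (rule measurable_grid_sum)

lemma grid_riemann_sum_eq_riemann_sum:
  "grid_riemann_sum L = riemann_sum L (\<lambda>k. real k * mesh_size L) (\<lambda>k. real k * mesh_size L)"
  by (simp add: fun_eq_iff grid_riemann_sum_def riemann_sum_def increment_sum_def step_integral_def
      increment_def)

lemma riemann_sum_grid_index_minus_grid_riemann_sum: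
  assumes "is_partition t N p" "0 < L"
  shows "riemann_sum N (\<lambda>i. real (grid_index L (p i)) * mesh_size L) \<sigma> \<omega> - grid_riemann_sum L \<omega>
    = grid_sum L (\<lambda>l. G (\<sigma> (block_index (\<lambda>i. grid_index L (p i)) l)) - G (real l * mesh_size L)) \<omega>"
proof -
  let ?q = "\<lambda>i. grid_index L (p i)"
  have "?q i \<le> ?q j" if "i \<le> j" "j \<le> N" for i j
    using is_partition_mono[OF assms(1) that] mesh_size_nonneg
    unfolding grid_index_def by (intro nat_mono floor_mono divide_right_mono) auto
  moreover have "?q 0 = 0" "?q N = L"
    using assms t_pos by (simp_all add: grid_index_def mesh_size_def is_partition_def)
  ultimately have "riemann_sum N (\<lambda>i. real (?q i) * mesh_size L) \<sigma>
      = grid_sum L (\<lambda>l. G (\<sigma> (block_index ?q l)))"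
    unfolding riemann_sum_def using step_integral_grid_eq_increment_sum[of N ?q] by simp
  then show ?thesis
    by (simp add: grid_riemann_sum_def increment_sum_def blinfun.diff_left sum_subtractf)
qed

lemma conv_in_prob_riemann_sum_grid_index:
  assumes part: "is_partition t N p"
  shows "riemann_sum N (\<lambda>i. real (grid_index L (p i)) * mesh_size L) \<sigma> \<in> borel_measurable M"
    and "conv_in_prob M (\<lambda>L. riemann_sum N (\<lambda>i. real (grid_index L (p i)) * mesh_size L) \<sigma>)
      (riemann_sum N p \<sigma>)"
  unfolding riemann_sum_def using is_partition_bounds[OF part] mesh_size_nonneg
  by (auto intro!: measurable_step_integral conv_in_prob_step_integral grid_index_tendsto)

lemma ex_eventually_close_in_prob_grid_riemann_sum:
  assumes "0 < \<epsilon>"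
  shows "\<exists>\<delta>>0. \<forall>N p \<sigma>. fine_tagged_partition t \<delta> N p \<sigma> \<longrightarrow>
    eventually (\<lambda>L. close_in_prob M \<epsilon> (riemann_sum N p \<sigma>) (grid_riemann_sum L)) sequentially"
proof -
  have "0 < \<epsilon> / 2" using assms by simp
  obtain \<delta> where "0 < \<delta>" and \<delta>: "\<And>L a b. \<forall>l<L. a l \<in> {0..t} \<and> b l \<in> {0..t} \<and> \<bar>a l - b l\<bar> < \<delta> \<Longrightarrow>
      close_in_prob M (\<epsilon> / 2) (grid_sum L (\<lambda>l. G (a l) - G (b l))) (\<lambda>_. 0)"
    using ex_close_in_prob_grid_sum_diff[OF \<open>0 < \<epsilon> / 2\<close>] by blast
  have "eventually (\<lambda>L. close_in_prob M \<epsilon> (riemann_sum N p \<sigma>) (grid_riemann_sum L)) sequentially"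
    if part: "fine_tagged_partition t (\<delta> / 2) N p \<sigma>" for N p \<sigma>
  proof -
    have is_part: "is_partition t N p" using part by (simp add: fine_tagged_partition_def)
    let ?p = "\<lambda>L i. real (grid_index L (p i)) * mesh_size L"
    note meas = conv_in_prob_riemann_sum_grid_index(1)[OF is_part] measurable_riemann_sum[OF is_part]
    have "eventually (\<lambda>L. close_in_prob M (\<epsilon> / 2) (riemann_sum N (?p L) \<sigma>) (riemann_sum N p \<sigma>))
        sequentially"
      using conv_in_prob_riemann_sum_grid_index(2)[OF is_part] \<open>0 < \<epsilon> / 2\<close>
      by (simp add: conv_in_prob_iff_eventually_close meas)
    moreover have "eventually (\<lambda>L. mesh_size L < \<delta> / 2) sequentially"
      using \<open>0 < \<delta>\<close> by (intro order_tendstoD(2)[OF mesh_size_tendsto_0]) simp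
    ultimately show ?thesis
      using eventually_gt_at_top[of 0]
    proof eventually_elim
      case (elim L)
      define a where "a l = \<sigma> (block_index (\<lambda>i. grid_index L (p i)) l)" for l
      have "a l \<in> {0..t}" "\<bar>a l - real l * mesh_size L\<bar> < \<delta>" "real l * mesh_size L \<in> {0..t}"
        if "l < L" for l
        using tag_near_grid_point[OF part elim(3) that] elim(2) grid_point_le[of l L] that
        by (auto simp: a_def mesh_size_nonneg)
      then have "close_in_prob M (\<epsilon> / 2) (grid_sum L (\<lambda>l. G (a l) - G (real l * mesh_size L))) (\<lambda>_. 0)"
        by (intro \<delta>) auto
      then have "close_in_prob M (\<epsilon> / 2) (riemann_sum N (?p L) \<sigma>) (grid_riemann_sum L)"
        unfolding a_def riemann_sum_grid_index_minus_grid_riemann_sum[OF is_part elim(3), symmetric]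
        by (subst close_in_prob_diff_0_iff[symmetric]) (simp add: eta_contract_eq)
      with elim(1)[THEN close_in_prob_commute[THEN iffD1]] show ?case
        by (rule close_in_prob_half_triangle[OF meas(2,1) measurable_grid_riemann_sum])
    qed
  qed
  then show ?thesis using \<open>0 < \<delta>\<close> by (intro exI[of _ "\<delta> / 2"]) simp
qed

lemma ex_conv_in_prob_grid_riemann_sum:
  obtains Y where "Y \<in> borel_measurable M" "conv_in_prob M grid_riemann_sum Y"
proof (rule conv_in_prob_if_Cauchy_in_prob[OF measurable_grid_riemann_sum])
  fix \<epsilon> :: real assume "0 < \<epsilon>"
  then have "0 < \<epsilon> / 2" by simp
  obtain \<delta> where "0 < \<delta>" and near: "\<And>N p \<sigma>. fine_tagged_partition t \<delta> N p \<sigma> \<Longrightarrow>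
      eventually (\<lambda>L. close_in_prob M (\<epsilon> / 2) (riemann_sum N p \<sigma>) (grid_riemann_sum L)) sequentially"
    using ex_eventually_close_in_prob_grid_riemann_sum[OF \<open>0 < \<epsilon> / 2\<close>] by blast
  have "eventually (\<lambda>m. mesh_size m < \<delta> \<and> 0 < m) sequentially"
    using \<open>0 < \<delta>\<close> by (intro eventually_conj order_tendstoD(2)[OF mesh_size_tendsto_0] eventually_gt_at_top)
  then obtain K where K_fine: "\<And>m. K \<le> m \<Longrightarrow> mesh_size m < \<delta> \<and> 0 < m"
    unfolding eventually_sequentially by blast
  have near_grid:
    "eventually (\<lambda>L. close_in_prob M (\<epsilon> / 2) (grid_riemann_sum m) (grid_riemann_sum L)) sequentially"
    if "K \<le> m" for m
    unfolding grid_riemann_sum_eq_riemann_sum[of m] mesh_size_def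
    using K_fine[OF that] t_pos
    by (intro near fine_tagged_partition_mono[OF fine_tagged_partition_equidistant])
      (simp_all add: mesh_size_def)
  have "close_in_prob M \<epsilon> (grid_riemann_sum m) (grid_riemann_sum n)" if "K \<le> m" "K \<le> n" for m n
  proof -
    from eventually_happens'[OF sequentially_bot
        eventually_conj[OF near_grid[OF that(1)] near_grid[OF that(2)]]]
    obtain L where "close_in_prob M (\<epsilon> / 2) (grid_riemann_sum m) (grid_riemann_sum L)"
      and n_L: "close_in_prob M (\<epsilon> / 2) (grid_riemann_sum n) (grid_riemann_sum L)" by blast
    from this(1) n_L[THEN close_in_prob_commute[THEN iffD1]] show ?thesis
      by (rule close_in_prob_half_triangle[OF measurable_grid_riemann_sum measurable_grid_riemann_sum
            measurable_grid_riemann_sum])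
  qed
  then show "\<exists>K. \<forall>m\<ge>K. \<forall>n\<ge>K. close_in_prob M \<epsilon> (grid_riemann_sum m) (grid_riemann_sum n)" by blast
qed (use that in blast)

lemma conv_in_prob_riemann_sum:
  assumes meas_Y: "Y \<in> borel_measurable M" and conv: "conv_in_prob M grid_riemann_sum Y"
    and part: "\<And>n. fine_tagged_partition t (\<delta> n) (N n) (p n) (\<sigma> n)" and \<delta>: "\<delta> \<longlonglongrightarrow> 0"
  shows "conv_in_prob M (\<lambda>n. riemann_sum (N n) (p n) (\<sigma> n)) Y"
proof -
  have meas: "riemann_sum (N n) (p n) (\<sigma> n) \<in> borel_measurable M" for n
    using part[of n] by (intro measurable_riemann_sum) (simp add: fine_tagged_partition_def)
  have "eventually (\<lambda>n. close_in_prob M \<epsilon> (riemann_sum (N n) (p n) (\<sigma> n)) Y) sequentially" if "0 < \<epsilon>" for \<epsilon>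
  proof -
    have "0 < \<epsilon> / 2" using that by simp
    obtain \<rho> where "0 < \<rho>" and near: "\<And>N p \<sigma>. fine_tagged_partition t \<rho> N p \<sigma> \<Longrightarrow>
        eventually (\<lambda>L. close_in_prob M (\<epsilon> / 2) (riemann_sum N p \<sigma>) (grid_riemann_sum L)) sequentially"
      using ex_eventually_close_in_prob_grid_riemann_sum[OF \<open>0 < \<epsilon> / 2\<close>] by blast
    have limit: "eventually (\<lambda>L. close_in_prob M (\<epsilon> / 2) (grid_riemann_sum L) Y) sequentially"
      using conv \<open>0 < \<epsilon> / 2\<close> by (simp add: conv_in_prob_iff_eventually_close meas_Y)
    show ?thesis
      using order_tendstoD(2)[OF \<delta> \<open>0 < \<rho>\<close>]
    proof eventually_elim
      case (elim n)
      then have "fine_tagged_partition t \<rho> (N n) (p n) (\<sigma> n)"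
        by (intro fine_tagged_partition_mono[OF part]) simp
      from eventually_happens'[OF sequentially_bot eventually_conj[OF near[OF this] limit]]
      obtain L where "close_in_prob M (\<epsilon> / 2) (riemann_sum (N n) (p n) (\<sigma> n)) (grid_riemann_sum L)"
        "close_in_prob M (\<epsilon> / 2) (grid_riemann_sum L) Y" by blast
      then show ?case by (rule close_in_prob_half_triangle[OF meas measurable_grid_riemann_sum meas_Y])
    qed
  qed
  then show ?thesis by (simp add: conv_in_prob_iff_eventually_close meas meas_Y)
qed

end

section \<open>Infinite divisibility\<close>

lemma (in prob_space) distr_sum_indep_vars:
  fixes X :: "'i \<Rightarrow> 'a \<Rightarrow> 'b::{second_countable_topology,topological_comm_monoid_add}"
  assumes indep: "indep_vars (\<lambda>_. borel) X I" and law: "\<And>i. i \<in> I \<Longrightarrow> distr M borel (X i) = D" and "I \<noteq> {}"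
  shows "distr M borel (\<lambda>\<omega>. \<Sum>i\<in>I. X i \<omega>) = distr (PiM I (\<lambda>_. D)) borel (\<lambda>x. \<Sum>i\<in>I. x i)"
proof -
  have meas_X: "(\<lambda>\<omega>. \<lambda>i\<in>I. X i \<omega>) \<in> measurable M (PiM I (\<lambda>_. borel))"
    using indep by (intro measurable_restrict) (simp add: indep_vars_def)
  have meas_sum: "(\<lambda>x. \<Sum>i\<in>I. x i) \<in> borel_measurable (PiM I (\<lambda>_. borel :: 'b measure))"
    by measurable
  have joint: "PiM I (\<lambda>_. D) = distr M (PiM I (\<lambda>_. borel)) (\<lambda>\<omega>. \<lambda>i\<in>I. X i \<omega>)"
    using distr_indep_vars_reindex[OF indep law, of id I] \<open>I \<noteq> {}\<close> by simp
  show ?thesis unfolding joint by (simp add: distr_distr[OF meas_sum meas_X] comp_def)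
qed

lemma distr_PiM_sum:
  fixes f :: "'a \<Rightarrow> 'b::{second_countable_topology,topological_comm_monoid_add}"
  assumes "prob_space M" and meas_f: "f \<in> borel_measurable M" and "finite I"
  shows "distr (PiM I (\<lambda>_. distr M borel f)) borel (\<lambda>x. \<Sum>i\<in>I. x i)
    = distr (PiM I (\<lambda>_. M)) borel (\<lambda>\<omega>. \<Sum>i\<in>I. f (\<omega> i))"
proof -
  interpret prob_space M by fact
  define D where "D = distr M borel f"
  have D_law: "prob_space D" "sets D = sets borel"
    unfolding D_def using meas_f by (auto intro: prob_space_distr)
  have f_D: "f \<in> measurable M D" using meas_f measurable_cong_sets[OF refl D_law(2)] by blast
  have "distr M D f = D" unfolding D_def by (intro distr_cong) auto
  then have product: "PiM I (\<lambda>_. D) = distr (PiM I (\<lambda>_. M)) (PiM I (\<lambda>_. D)) (compose I f)"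
    using distr_PiM_finite_prob_space'[of I "\<lambda>_. M" "\<lambda>_. D" f] D_law f_D \<open>finite I\<close> prob_space_axioms by simp
  have meas_compose: "compose I f \<in> measurable (PiM I (\<lambda>_. M)) (PiM I (\<lambda>_. D))"
    unfolding compose_def
    by (intro measurable_restrict measurable_compose[OF _ f_D] measurable_component_singleton)
  have "(\<lambda>x. x i) \<in> borel_measurable (PiM I (\<lambda>_. D))" if "i \<in> I" for i
    using measurable_component_singleton[OF that, of "\<lambda>_. D"] measurable_cong_sets[OF refl D_law(2)] by blast
  then have meas_sum: "(\<lambda>x. \<Sum>i\<in>I. x i) \<in> borel_measurable (PiM I (\<lambda>_. D))"
    by (intro borel_measurable_sum)
  show ?thesis
    unfolding D_def[symmetric]
    by (subst product, subst distr_distr[OF meas_sum meas_compose]) (simp add: comp_def compose_def)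
qed

lemma conv_in_prob_PiM_component:
  fixes X :: "nat \<Rightarrow> 'a \<Rightarrow> 'b::{metric_space,second_countable_topology}"
  assumes "prob_space M" and conv: "conv_in_prob M X Y" and "i \<in> I"
    and [measurable]: "\<And>n. X n \<in> borel_measurable M" "Y \<in> borel_measurable M"
  shows "conv_in_prob (PiM I (\<lambda>_. M)) (\<lambda>n \<omega>. X n (\<omega> i)) (\<lambda>\<omega>. Y (\<omega> i))"
proof -
  let ?P = "PiM I (\<lambda>_. M)"
  have component: "(\<lambda>\<omega>. \<omega> i) \<in> measurable ?P M"
    using \<open>i \<in> I\<close> by (rule measurable_component_singleton)
  have "measure M {\<omega>\<in>space M. \<epsilon> < dist (X n \<omega>) (Y \<omega>)}
      = measure ?P {\<omega>\<in>space ?P. \<epsilon> < dist (X n (\<omega> i)) (Y (\<omega> i))}" for \<epsilon> n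
  proof -
    let ?A = "{\<omega>\<in>space M. \<epsilon> < dist (X n \<omega>) (Y \<omega>)}"
    have "measure M ?A = measure (distr ?P M (\<lambda>\<omega>. \<omega> i)) ?A"
      using distr_PiM_component[of I "\<lambda>_. M" i] assms by simp
    also have "\<dots> = measure ?P ((\<lambda>\<omega>. \<omega> i) -` ?A \<inter> space ?P)"
      by (rule measure_distr[OF component]) measurable
    also have "(\<lambda>\<omega>. \<omega> i) -` ?A \<inter> space ?P = {\<omega>\<in>space ?P. \<epsilon> < dist (X n (\<omega> i)) (Y (\<omega> i))}"
      using measurable_space[OF component] by auto
    finally show ?thesis .
  qed
  then show ?thesis using conv by (simp add: conv_in_prob_def)
qed

text \<open>The limits of the \<open>n\<close>-th roots of the laws of \<open>X L\<close> are taken on the \<open>n\<close>-fold product space, where the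
  summands converge independently.\<close>

lemma (in prob_space) infinitely_divisible_limit_in_prob:
  fixes X :: "nat \<Rightarrow> 'a \<Rightarrow> 'b::{real_normed_vector,second_countable_topology}"
  assumes meas_X: "\<And>L. X L \<in> borel_measurable M" and meas_Y: "Y \<in> borel_measurable M"
    and conv: "conv_in_prob M X Y"
    and roots: "\<And>n::nat. 1 \<le> n \<Longrightarrow>
      \<exists>W V. (\<forall>L. W L \<in> borel_measurable M) \<and> V \<in> borel_measurable M \<and> conv_in_prob M W V \<and>
      (\<forall>L. distr M borel (X L) = distr (PiM {..<n} (\<lambda>_. distr M borel (W L))) borel (\<lambda>x. \<Sum>i<n. x i))"
  shows "infinitely_divisible (distr M borel Y)"
  unfolding infinitely_divisible_def
proof (intro conjI allI impI)
  show "prob_space (distr M borel Y)" using meas_Y by (rule prob_space_distr)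
  fix n :: nat assume "1 \<le> n"
  then obtain W V where meas_W: "\<And>L. W L \<in> borel_measurable M" and meas_V: "V \<in> borel_measurable M"
    and conv_W: "conv_in_prob M W V"
    and root: "\<And>L. distr M borel (X L) = distr (PiM {..<n} (\<lambda>_. distr M borel (W L))) borel (\<lambda>x. \<Sum>i<n. x i)"
    using roots by metis
  let ?P = "PiM {..<n} (\<lambda>_. M)"
  interpret P: prob_space ?P by (intro prob_space_PiM prob_space_axioms)
  have component: "(\<lambda>\<omega>. f (\<omega> i)) \<in> borel_measurable ?P"
    if "i < n" "f \<in> borel_measurable M" for f :: "'a \<Rightarrow> 'b" and i
    using that by (intro measurable_compose[OF measurable_component_singleton]) auto
  have "distr M borel Y = distr ?P borel (\<lambda>\<omega>. \<Sum>i<n. V (\<omega> i))"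
  proof (rule distr_eq_if_conv_in_prob[OF prob_space_axioms meas_X meas_Y P.prob_space_axioms _ _ conv])
    show "(\<lambda>\<omega>. \<Sum>i<n. W L (\<omega> i)) \<in> borel_measurable ?P" "(\<lambda>\<omega>. \<Sum>i<n. V (\<omega> i)) \<in> borel_measurable ?P" for L
      by (intro borel_measurable_sum component meas_W meas_V; simp)+
    show "conv_in_prob ?P (\<lambda>L \<omega>. \<Sum>i<n. W L (\<omega> i)) (\<lambda>\<omega>. \<Sum>i<n. V (\<omega> i))"
      by (intro P.conv_in_prob_sum component meas_W meas_V finite_lessThan
          conv_in_prob_PiM_component[OF prob_space_axioms conv_W _ meas_W meas_V]) auto
    show "distr M borel (X L) = distr ?P borel (\<lambda>\<omega>. \<Sum>i<n. W L (\<omega> i))" for L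
      by (simp add: root distr_PiM_sum[OF prob_space_axioms meas_W])
  qed
  also have "\<dots> = distr (PiM {..<n} (\<lambda>_. distr M borel V)) borel (\<lambda>x. \<Sum>i<n. x i)"
    by (rule distr_PiM_sum[OF prob_space_axioms meas_V finite_lessThan, symmetric])
  finally show "\<exists>\<nu>. prob_space \<nu> \<and> sets \<nu> = sets borel \<and>
      distr M borel Y = distr (PiM {..<n} (\<lambda>_. \<nu>)) borel (\<lambda>x. \<Sum>i<n. x i)"
    using prob_space_distr[OF meas_V] by (intro exI[of _ "distr M borel V"]) auto
qed simp

context stationary_increments
begin

lemma time_scaled:
  assumes "0 < c"
  shows "stationary_increments M (\<lambda>u. Z (u / c))"
proof
  show "Z (u / c) \<in> borel_measurable M" if "0 \<le> u" for u
    using that assms by (intro measurable_process) simp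
  show "indep_vars (\<lambda>_. borel) (\<lambda>k \<omega>. Z (r (Suc k) / c) \<omega> - Z (r k / c) \<omega>) {..<n}"
    if "0 \<le> r 0" "\<And>k. k < n \<Longrightarrow> r k \<le> r (Suc k)" for n :: nat and r
    using that assms by (intro indep_increments[of "\<lambda>k. r k / c"]) (auto intro: divide_right_mono)
  show "distr M borel (\<lambda>\<omega>. Z ((s + h) / c) \<omega> - Z (s / c) \<omega>) = distr M borel (\<lambda>\<omega>. Z (h / c) \<omega> - Z (0 / c) \<omega>)"
    if "0 \<le> s" "0 \<le> h" for s h
    using stationary[of "s / c" "h / c"] that assms by (simp add: add_divide_distrib)
  show "conv_in_prob M (\<lambda>k. Z (u k / c)) (Z (v / c))"
    if "\<And>k. 0 \<le> u k" "0 \<le> v" "u \<longlonglongrightarrow> v" for u v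
    using that assms by (intro stochastically_continuous tendsto_divide tendsto_const) auto
qed

lemma increment_eq_sum_increment: "increment (real n * h) k \<omega> = (\<Sum>j<n. increment h (k * n + j) \<omega>)"
proof -
  have "(\<Sum>j<n. increment h (k * n + j) \<omega>) = Z (real (k * n + n) * h) \<omega> - Z (real (k * n) * h) \<omega>"
    using sum_lessThan_telescope[of "\<lambda>j. Z (real (k * n + j) * h) \<omega>" n] by (simp add: increment_def)
  then show ?thesis by (simp add: increment_def algebra_simps)
qed

definition subgrid_sum :: "real \<Rightarrow> nat \<Rightarrow> nat \<Rightarrow> (nat \<Rightarrow> 'h \<Rightarrow>\<^sub>L 'h) \<Rightarrow> nat \<Rightarrow> 'a \<Rightarrow> 'h" where
  "subgrid_sum h n L \<Phi> j \<omega> = (\<Sum>k<L. \<Phi> k (increment h (k * n + j) \<omega>))"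

lemma increment_sum_eq_sum_subgrid_sum: "increment_sum (real n * h) L \<Phi> \<omega> = (\<Sum>j<n. subgrid_sum h n L \<Phi> j \<omega>)"
  unfolding increment_sum_def subgrid_sum_def increment_eq_sum_increment blinfun.sum_right
  by (rule sum.swap)

lemma distr_sum_increment_reindex:
  fixes \<Phi> :: "nat \<Rightarrow> 'h \<Rightarrow>\<^sub>L 'h"
  assumes h_nonneg: "0 \<le> h" and inj_f: "inj_on f {..<L}"
  shows "distr M borel (\<lambda>\<omega>. \<Sum>k<L. \<Phi> k (increment h (f k) \<omega>)) = distr M borel (increment_sum h L \<Phi>)"
proof (cases "L = 0")
  case False
  have law: "distr M borel (\<lambda>\<omega>. \<Sum>k<L. \<Phi> k (increment h (g k) \<omega>))
      = distr (PiM {..<L} (\<lambda>_. distr M borel (\<lambda>\<omega>. Z h \<omega> - Z 0 \<omega>))) borel (\<lambda>x. \<Sum>k<L. \<Phi> k (x k))"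
    if inj_g: "inj_on g {..<L}" for g
  proof -
    obtain N where g_image: "g ` {..<L} \<subseteq> {..<N}"
      using finite_nat_iff_bounded by blast
    have meas_X: "(\<lambda>\<omega>. \<lambda>k\<in>{..<L}. increment h (g k) \<omega>) \<in> measurable M (PiM {..<L} (\<lambda>_. borel))"
      by (intro measurable_restrict measurable_increment h_nonneg)
    have meas_sum: "(\<lambda>x. \<Sum>k<L. \<Phi> k (x k)) \<in> borel_measurable (PiM {..<L} (\<lambda>_. borel))"
      by (intro borel_measurable_sum borel_measurable_blinfun_apply_const measurable_component_singleton)
    show ?thesis
      using False
      by (subst distr_indep_vars_reindex[OF indep_vars_increment[OF h_nonneg]
            distr_increment[OF h_nonneg] inj_g g_image, symmetric])
        (simp_all add: distr_distr[OF meas_sum meas_X] comp_def lessThan_empty_iff)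
  qed
  show ?thesis
    using law[OF inj_f] law[of "\<lambda>k. k"] by (simp add: increment_sum_def[abs_def] inj_on_def)
qed (simp add: increment_sum_def[abs_def])

lemma distr_subgrid_sum:
  assumes "0 \<le> h" "0 < n"
  shows "distr M borel (subgrid_sum h n L \<Phi> j) = distr M borel (increment_sum h L \<Phi>)"
  unfolding subgrid_sum_def[abs_def] using assms
  by (intro distr_sum_increment_reindex) (auto simp: inj_on_def)

lemma indep_vars_subgrid_sum:
  assumes h_nonneg: "0 \<le> h"
  shows "indep_vars (\<lambda>_. borel) (subgrid_sum h n L \<Phi>) {..<n}"
proof -
  define K where "K j = (\<lambda>k. k * n + j) ` {..<L}" for j
  have "indep_vars (\<lambda>j. PiM (K j) (\<lambda>_. borel)) (\<lambda>j \<omega>. \<lambda>i\<in>K j. increment h i \<omega>) {..<n}"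
  proof (rule indep_vars_restrict[OF indep_vars_increment[OF h_nonneg, of "L * n"]])
    fix j assume j: "j \<in> {..<n}"
    have "k * n + j < L * n" if "k < L" for k
    proof -
      have "k * n + j < Suc k * n" using j by simp
      also have "\<dots> \<le> L * n" using that by (intro mult_le_mono1) simp
      finally show ?thesis .
    qed
    then show "K j \<subseteq> {..<L * n}" by (auto simp: K_def)
  next
    have "i mod n = j" if "i \<in> K j" "j < n" for i j
      using that by (auto simp: K_def)
    then show "disjoint_family_on K {..<n}"
      unfolding disjoint_family_on_def by (metis disjoint_iff lessThan_iff)
  qed
  then have "indep_vars (\<lambda>_. borel)
      (\<lambda>j \<omega>. (\<lambda>x. \<Sum>k<L. \<Phi> k (x (k * n + j))) (\<lambda>i\<in>K j. increment h i \<omega>)) {..<n}"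
    by (rule indep_vars_compose2)
      (intro borel_measurable_sum borel_measurable_blinfun_apply_const measurable_component_singleton,
        auto simp: K_def)
  then show ?thesis
    by (rule iffD1[OF indep_vars_cong, rotated 3]) (auto simp: subgrid_sum_def K_def fun_eq_iff)
qed

text \<open>Collecting the \<open>j\<close>-th subcells of all \<open>L\<close> cells gives \<open>n\<close> independent sums with the same law.\<close>

lemma distr_increment_sum_refine:
  assumes "0 \<le> h" "0 < n"
  shows "distr M borel (increment_sum (real n * h) L \<Phi>)
    = distr (PiM {..<n} (\<lambda>_. distr M borel (increment_sum h L \<Phi>))) borel (\<lambda>x. \<Sum>j<n. x j)"
  using distr_sum_indep_vars[OF indep_vars_subgrid_sum distr_subgrid_sum, OF assms(1) assms] assms(2)
  by (simp add: increment_sum_eq_sum_subgrid_sum[abs_def] lessThan_empty_iff)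

end

lemma (in stochastic_integral) infinitely_divisible_limit:
  assumes meas_Y: "Y \<in> borel_measurable M" and conv: "conv_in_prob M grid_riemann_sum Y"
  shows "infinitely_divisible (distr M borel Y)"
proof (rule infinitely_divisible_limit_in_prob[OF measurable_grid_riemann_sum meas_Y conv])
  fix n :: nat assume n: "1 \<le> n"
  interpret S: stochastic_integral M "\<lambda>u. Z (u / real n)" G t C
    using n
    by (intro stochastic_integral.intro time_scaled stochastic_integral_axioms.intro
        t_pos G_bound G_continuous) auto
  obtain V where V: "V \<in> borel_measurable M" "conv_in_prob M S.grid_riemann_sum V"
    using S.ex_conv_in_prob_grid_riemann_sum .
  have "S.grid_riemann_sum L = increment_sum (mesh_size L / real n) L (\<lambda>l. G (real l * mesh_size L))" for L
    by (simp add: fun_eq_iff S.grid_riemann_sum_def S.increment_sum_def S.increment_def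
        increment_sum_def increment_def)
  then have "distr M borel (grid_riemann_sum L)
      = distr (PiM {..<n} (\<lambda>_. distr M borel (S.grid_riemann_sum L))) borel (\<lambda>x. \<Sum>i<n. x i)" for L
    using distr_increment_sum_refine[of "mesh_size L / real n" n L] n mesh_size_nonneg[of L]
    by (simp add: grid_riemann_sum_def)
  then show "\<exists>W V. (\<forall>L. W L \<in> borel_measurable M) \<and> V \<in> borel_measurable M \<and> conv_in_prob M W V \<and>
      (\<forall>L. distr M borel (grid_riemann_sum L)
        = distr (PiM {..<n} (\<lambda>_. distr M borel (W L))) borel (\<lambda>x. \<Sum>i<n. x i))"
    using V by (intro exI[of _ S.grid_riemann_sum] exI[of _ V]) auto
qed

lemma levy_process_stationary_increments:
  assumes "levy_process M F Z"
  shows "stationary_increments M Z"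
proof (intro stationary_increments.intro stationary_increments_axioms.intro)
  show "prob_space M" using assms by (simp add: levy_process_def)
  show "Z u \<in> borel_measurable M" if "0 \<le> u" for u
  proof -
    have "subalgebra M (F u)" "Z u \<in> borel_measurable (F u)"
      using assms that by (simp_all add: levy_process_def is_filtration_def subalgebra_def)
    then show ?thesis by (rule measurable_from_subalg)
  qed
  show "prob_space.indep_vars M (\<lambda>_. borel) (\<lambda>k \<omega>. Z (r (Suc k)) \<omega> - Z (r k) \<omega>) {..<n}"
    if "0 \<le> r 0" "\<And>k. k < n \<Longrightarrow> r k \<le> r (Suc k)" for n :: nat and r
    using assms that by (simp add: levy_process_def)
  show "distr M borel (\<lambda>\<omega>. Z (s + h) \<omega> - Z s \<omega>) = distr M borel (\<lambda>\<omega>. Z h \<omega> - Z 0 \<omega>)"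
    if "0 \<le> s" "0 \<le> h" for s h
    using assms that unfolding levy_process_def by blast
  show "conv_in_prob M (\<lambda>k. Z (u k)) (Z v)"
    if u: "\<And>k. 0 \<le> u k" "0 \<le> v" "u \<longlonglongrightarrow> v" for u v
    unfolding conv_in_prob_def
  proof (intro allI impI)
    fix \<epsilon> :: real assume "0 < \<epsilon>"
    let ?f = "\<lambda>s. measure M {\<omega>\<in>space M. \<epsilon> < dist (Z s \<omega>) (Z v \<omega>)}"
    have f_v: "?f v = 0" using \<open>0 < \<epsilon>\<close> by simp
    have "(?f \<longlongrightarrow> 0) (at v within {0..})"
      using assms u(2) \<open>0 < \<epsilon>\<close> unfolding levy_process_def by blast
    then have "continuous (at v within {0..}) ?f" unfolding continuous_within f_v .
    then have "(\<lambda>k. ?f (u k)) \<longlonglongrightarrow> ?f v"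
      by (rule continuous_within_tendsto_compose') (use u in auto)
    then show "(\<lambda>k. ?f (u k)) \<longlonglongrightarrow> 0" unfolding f_v .
  qed
qed

lemma resolvent_family_stochastic_integral:
  assumes R: "resolvent_family D A a R" and Z: "levy_process M F Z" and "0 < t"
  obtains C where "stochastic_integral M Z (\<lambda>u. R (t - u)) t C"
proof -
  obtain C where C: "\<And>u. u \<in> {0..t} \<Longrightarrow> norm (R u) \<le> C"
    using R \<open>0 < t\<close> unfolding resolvent_family_def by (meson less_imp_le)
  have "continuous_on {0..} (\<lambda>u. R u x)" for x
    using R unfolding resolvent_family_def by blast
  then have "continuous_on {0..t} (\<lambda>u. R (t - u) x)" for x
    by (rule continuous_on_compose2) (auto intro!: continuous_intros)
  then show thesis
    using C \<open>0 < t\<close>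
    by (intro that[of C] stochastic_integral.intro stochastic_integral_axioms.intro
        levy_process_stationary_increments[OF Z]) auto
qed

theorem theorem3:
  fixes D :: "('h::{real_inner,complete_space,second_countable_topology}) set"
    and A :: "'h \<Rightarrow> 'h"
    and a :: "real \<Rightarrow> real"
    and R :: "real \<Rightarrow> ('h \<Rightarrow>\<^sub>L 'h)"
    and M :: "'a measure"
    and F :: "real \<Rightarrow> 'a measure"
    and Z :: "real \<Rightarrow> 'a \<Rightarrow> 'h"
    and t :: real
  assumes "closed_dense_operator D A"
    and "loc_integrable_Rplus a"
    and "resolvent_family D A a R"
    and "levy_process M F Z"
    and "t > 0"
  shows "\<exists>Y. Y \<in> borel_measurable M \<and>
           infinitely_divisible (distr M borel Y) \<and>
           (\<forall>(N::nat \<Rightarrow> nat) (p::nat \<Rightarrow> nat \<Rightarrow> real) (s::nat \<Rightarrow> nat \<Rightarrow> real).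
              (\<forall>n. is_partition t (N n) (p n)) \<and>
              (\<lambda>n. mesh (N n) (p n)) \<longlonglongrightarrow> 0 \<and>
              (\<forall>n. \<forall>i<N n. p n i \<le> s n i \<and> s n i \<le> p n (Suc i))
              \<longrightarrow> conv_in_prob M
                    (\<lambda>n. step_integral Z
                           (\<lambda>k. R (s n (N n - Suc k)))
                           (\<lambda>k. t - p n (N n - k))
                           (N n))
                    Y)"
proof -
  obtain C where "stochastic_integral M Z (\<lambda>u. R (t - u)) t C"
    using resolvent_family_stochastic_integral[OF assms(3-5)] .
  then interpret stochastic_integral M Z "\<lambda>u. R (t - u)" t C .
  obtain Y where Y: "Y \<in> borel_measurable M" "conv_in_prob M grid_riemann_sum Y"
    using ex_conv_in_prob_grid_riemann_sum .
  have "conv_in_prob M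
      (\<lambda>n. step_integral Z (\<lambda>k. R (s n (N n - Suc k))) (\<lambda>k. t - p n (N n - k)) (N n)) Y"
    if "\<And>n. is_partition t (N n) (p n)" "(\<lambda>n. mesh (N n) (p n)) \<longlonglongrightarrow> 0"
      "\<And>n i. i < N n \<Longrightarrow> p n i \<le> s n i \<and> s n i \<le> p n (Suc i)" for N p s
    using conv_in_prob_riemann_sum[OF Y fine_tagged_partition_reverse[OF that(1,3)] that(2)]
    by (simp add: riemann_sum_def)
  then show ?thesis using Y infinitely_divisible_limit[OF Y] by blast
qed

end
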